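(* Let $K$ be a commutative field with $\operatorname{Char}K=3$. Let $F\subset\mathbb{P}_3(K)$ be the Cayley surface $F=\mathcal{V}(X_0X_1X_2-X_1^3-X_0^2X_3)$, let $g_\infty=\mathcal{V}(X_0,X_1)$, and let $\mathcal{O}$ be the set of lines of $\mathbb{P}_3(K)$ consisting of all proper osculating tangents of $F$ together with $g_\infty$. Let $\mathcal{L}[Z,\omega]$ be the pencil of all lines that lie in the plane $\omega=\mathcal{V}(X_0)$ and pass through the point $Z=K(0,0,0,1)^T$. Then $\mathcal{O}\cup\mathcal{L}[Z,\omega]$ is a subset of a parabolic linear congruence $\mathcal{N}$ whose Klein image equals the quadratic cone $Q\cap D$, where $Q$ is the Klein quadric and $$D:=\mathcal{V}(Y_{02},\,Y_{03}+Y_{12})$$ is a three-dimensional subspace of $\mathbb{P}_5(K)$. The axis of the congruence $\mathcal{N}$ is the line of nuclei $n=\mathcal{V}(X_0,X_2)$. The congruence $\mathcal{N}$ coincides with $\mathcal{O}\cup\mathcal{L}[Z,\omega]$ if, and only if, each element of $K$ has a third root in $K$.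
   Context: Points of the projective space $\mathbb{P}_3(K)$ are the one-dimensional subspaces $K\mathbf{p}$ with $0\neq\mathbf{p}=(p_0,p_1,p_2,p_3)^{T}\in K^{4\times1}$; similarly for $\mathbb{P}_5(K)$ with $K^{6\times 1}$. For homogeneous polynomials $g_1,\dots,g_r$ over $K$, $\mathcal{V}(g_1,\dots,g_r)$ denotes the set of ($K$-rational) points at which $g_1,\dots,g_r$ all vanish, in $\mathbb{P}_3(K)$ for polynomials in $X_0,\dots,X_3$ and in $\mathbb{P}_5(K)$ for polynomials in $Y_{01},Y_{02},Y_{03},Y_{12},Y_{13},Y_{23}$. Put $f:=X_0X_1X_2-X_1^3-X_0^2X_3$, so $F=\mathcal{V}(f)$. A point of $F$ is simple if not all the partial derivatives $\partial f/\partial X_i$ vanish there. The simple points of $F$ are exactly the points of $F$ outside $\omega$, namely $P(u_1,u_2)=K(1,u_1,u_2,u_1u_2-u_1^3)^T$ with $(u_1,u_2)\in K^2$. A generator of $F$ is one of the lines spanned by $K(s_0^2,s_0s_1,s_1^2,0)^T$ and $K(0,0,s_0,s_1)^T$, with $(s_0,s_1)\in K^2\setminus\{(0,0)\}$; these are the lines contained in $F$. A line $t$ is an osculating tangent of $F$ at a simple point $P=K\mathbf{p}$ if it meets $F$ at $P$ with multiplicity $\geq 3$: for $t=K\mathbf{p}+K\mathbf{q}$ the polynomial $f(\mathbf{p}+T\mathbf{q})\in K[T]$ is divisible by $T^3$ (possibly zero). A proper osculating tangent of $F$ is an osculating tangent at some simple point that is not a generator of $F$. In characteristic $3$, a nucleus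 of $F$ is a point off $F$ at which all partial derivatives of $f$ vanish; every point of $n\setminus\{Z\}$, $n=\mathcal{V}(X_0,X_2)$, is a nucleus, and $n$ is called the line of nuclei. The Klein mapping $\kappa$ sends a line $K\mathbf{p}+K\mathbf{q}$ of $\mathbb{P}_3(K)$ to the point $K(y_{01},y_{02},y_{03},y_{12},y_{13},y_{23})^T$ of $\mathbb{P}_5(K)$, where $y_{ij}=p_iq_j-p_jq_i$ (Plücker coordinates); it is a bijection from the set of lines of $\mathbb{P}_3(K)$ onto the Klein quadric $Q=\mathcal{V}(Y_{01}Y_{23}-Y_{02}Y_{13}+Y_{03}Y_{12})$. Let $\perp$ denote the polarity of $Q$. A parabolic linear congruence is a set of lines of $\mathbb{P}_3(K)$ whose Klein image is of the form $Q\cap D$, where $D$ is a three-dimensional projective subspace of $\mathbb{P}_5(K)$ such that the line $D^\perp$ is a tangent of $Q$ not contained in $Q$ (so it meets $Q$ in exactly one point); then $Q\cap D$ is a quadratic cone whose vertex is the point $D^\perp\cap Q$, and the axis of the congruence is the line of $\mathbb{P}_3(K)$ whose Klein image is this vertex. A third root of $a\in K$ is an element $b\in K$ with $b^3=a$. *)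

theory Defs
  imports
    "HOL-Analysis.Cartesian_Space"
    "HOL-Computational_Algebra.Polynomial"
    "HOL-Library.Poly_Mapping"
begin

section \<open>Formal polynomials in finitely many indeterminates\<close>

text \<open>Polynomials are formal objects, not functions, since the field may be finite.\<close>

type_synonym ('i, 'a) mpoly = "('i \<Rightarrow>\<^sub>0 nat) \<Rightarrow>\<^sub>0 'a"

definition indet :: "'i \<Rightarrow> ('i, 'a::{zero,one}) mpoly" where
  "indet i = Poly_Mapping.single (Poly_Mapping.single i 1) 1"

text \<open>Substitution of \<open>v i\<close>, in an extension ring, for the indeterminate number \<open>i\<close>;
  \<open>h\<close> embeds the coefficients into that ring.\<close>

definition subst_poly ::
  "('a::zero \<Rightarrow> 'b::comm_ring_1) \<Rightarrow> ('i::finite \<Rightarrow> 'b) \<Rightarrow> ('i, 'a) mpoly \<Rightarrow> 'b" where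
  "subst_poly h v g =
     (\<Sum>m\<in>Poly_Mapping.keys g. h (Poly_Mapping.lookup g m) * (\<Prod>i\<in>UNIV. v i ^ Poly_Mapping.lookup m i))"

definition eval_poly :: "('i::finite, 'a::comm_ring_1) mpoly \<Rightarrow> 'a ^ 'i \<Rightarrow> 'a" where
  "eval_poly g x = subst_poly (\<lambda>c. c) (\<lambda>i. x $ i) g"

text \<open>The polynomial \<open>g(p + T q)\<close> in one indeterminate \<open>T\<close>.\<close>

definition restrict_to_line ::
  "('i::finite, 'a::comm_ring_1) mpoly \<Rightarrow> 'a ^ 'i \<Rightarrow> 'a ^ 'i \<Rightarrow> 'a poly" where
  "restrict_to_line g p q = subst_poly (\<lambda>c. [:c:]) (\<lambda>i. [:p $ i, q $ i:]) g"

definition partial_deriv :: "'i \<Rightarrow> ('i, 'a::comm_ring_1) mpoly \<Rightarrow> ('i, 'a) mpoly" where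
  "partial_deriv i g =
     (\<Sum>m\<in>Poly_Mapping.keys g.
        Poly_Mapping.single (m - Poly_Mapping.single i 1)
          (of_nat (Poly_Mapping.lookup m i) * Poly_Mapping.lookup g m))"

definition homogeneous_of_degree :: "nat \<Rightarrow> ('i::finite, 'a::zero) mpoly \<Rightarrow> bool" where
  "homogeneous_of_degree d g \<longleftrightarrow>
     (\<forall>m\<in>Poly_Mapping.keys g. (\<Sum>i\<in>UNIV. Poly_Mapping.lookup m i) = d)"

text \<open>The polar form of a quadratic form.\<close>

definition polar_form :: "('i::finite, 'a::comm_ring_1) mpoly \<Rightarrow> 'a ^ 'i \<Rightarrow> 'a ^ 'i \<Rightarrow> 'a" where
  "polar_form g x y = eval_poly g (x + y) - eval_poly g x - eval_poly g y"


section \<open>Projective spaces\<close>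

text \<open>A point is a one-dimensional linear subspace; every other projective subspace is
  the set of its points.\<close>

type_synonym ('a, 'n) point = "('a ^ 'n) set"

definition is_point :: "('a::field, 'n::finite) point \<Rightarrow> bool" where
  "is_point P \<longleftrightarrow> vec.subspace P \<and> vec.dim P = 1"

definition points_of :: "('a::field ^ 'n::finite) set \<Rightarrow> ('a, 'n) point set" where
  "points_of U = {P. is_point P \<and> P \<subseteq> U}"

definition is_proj_subspace :: "nat \<Rightarrow> ('a::field, 'n::finite) point set \<Rightarrow> bool" where
  "is_proj_subspace d S \<longleftrightarrow>
     (\<exists>U. vec.subspace U \<and> vec.dim U = d + 1 \<and> S = points_of U)"

definition is_line :: "('a::field, 'n::finite) point set \<Rightarrow> bool" where
  "is_line l \<longleftrightarrow> is_proj_subspace 1 l"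

definition pt :: "'a::field ^ 'n::finite \<Rightarrow> ('a, 'n) point" where
  "pt p = vec.span {p}"

definition join :: "'a::field ^ 'n::finite \<Rightarrow> 'a ^ 'n \<Rightarrow> ('a, 'n) point set" where
  "join p q = points_of (vec.span {p, q})"

text \<open>Meant for homogeneous polynomials of positive degree.\<close>

definition zero_set :: "('n::finite, 'a::field) mpoly set \<Rightarrow> ('a, 'n) point set" where
  "zero_set G = {P. is_point P \<and> (\<forall>g\<in>G. \<forall>x\<in>P. eval_poly g x = 0)}"

text \<open>A cone over a non-empty, non-degenerate conic \<open>C\<close> of a plane \<open>E\<close> not through the
  vertex \<open>V\<close>. Non-degeneracy is expressed by the polar form, which is adequate in
  characteristic \<open>\<noteq> 2\<close>.\<close>

definition nondegenerate_conic ::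
  "('a::field, 'n::finite) point set \<Rightarrow> ('a, 'n) point set \<Rightarrow> bool" where
  "nondegenerate_conic E C \<longleftrightarrow>
     (\<exists>g. homogeneous_of_degree 2 g \<and> C = E \<inter> zero_set {g} \<and> C \<noteq> {} \<and>
          (\<forall>x\<in>\<Union>E. (\<forall>y\<in>\<Union>E. polar_form g x y = 0) \<longrightarrow> x = 0))"

definition quadratic_cone :: "('a::field, 'n::finite) point set \<Rightarrow> bool" where
  "quadratic_cone S \<longleftrightarrow>
     (\<exists>V E C. is_point V \<and> is_proj_subspace 2 E \<and> V \<notin> E \<and> nondegenerate_conic E C \<and>
        S = (\<Union>X\<in>C. points_of (vec.span (V \<union> X))))"


section \<open>The Cayley surface\<close>

text \<open>The indices \<open>0, 1, 2, 3\<close> are the elements of the numeral type \<open>4\<close>.\<close>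

definition vec4 :: "'a \<Rightarrow> 'a \<Rightarrow> 'a \<Rightarrow> 'a \<Rightarrow> 'a ^ 4" where
  "vec4 a b c d = (\<chi> i. if i = 0 then a else if i = 1 then b else if i = 2 then c else d)"

abbreviation X :: "4 \<Rightarrow> (4, 'a::field) mpoly" where
  "X \<equiv> indet"

definition cayley_poly :: "(4, 'a::field) mpoly" where
  "cayley_poly = X 0 * X 1 * X 2 - X 1 ^ 3 - X 0 ^ 2 * X 3"

definition cayley_surface :: "('a::field, 4) point set" where
  "cayley_surface = zero_set {cayley_poly}"

definition simple_point :: "('a::field, 4) point \<Rightarrow> bool" where
  "simple_point P \<longleftrightarrow>
     P \<in> cayley_surface \<and> P \<notin> zero_set (range (\<lambda>i. partial_deriv i cayley_poly))"

definition generator :: "('a::field, 4) point set \<Rightarrow> bool" where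
  "generator l \<longleftrightarrow>
     (\<exists>s0 s1. (s0, s1) \<noteq> (0, 0) \<and>
        l = join (vec4 (s0 ^ 2) (s0 * s1) (s1 ^ 2) 0) (vec4 0 0 s0 s1))"

text \<open>Whether \<open>T ^ 3\<close> divides \<open>f(p + T q)\<close> depends only on the point \<open>K p\<close> and on the line
  \<open>K p + K q\<close>.\<close>

definition osculating_tangent_at ::
  "('a::field, 4) point \<Rightarrow> ('a, 4) point set \<Rightarrow> bool" where
  "osculating_tangent_at P t \<longleftrightarrow>
     simple_point P \<and> is_line t \<and>
     (\<exists>p q. P = pt p \<and> t = join p q \<and>
        monom 1 3 dvd restrict_to_line cayley_poly p q)"

definition proper_osculating_tangent :: "('a::field, 4) point set \<Rightarrow> bool" where
  "proper_osculating_tangent t \<longleftrightarrow> (\<exists>P. osculating_tangent_at P t) \<and> \<not> generator t"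

definition g_inf :: "('a::field, 4) point set" where
  "g_inf = zero_set {X 0, X 1}"

definition osculating_lines :: "('a::field, 4) point set set" where
  "osculating_lines = {t. proper_osculating_tangent t} \<union> {g_inf}"

definition omega :: "('a::field, 4) point set" where
  "omega = zero_set {X 0}"

definition pencil ::
  "('a::field, 4) point \<Rightarrow> ('a, 4) point set \<Rightarrow> ('a, 4) point set set" where
  "pencil P e = {l. is_line l \<and> P \<in> l \<and> l \<subseteq> e}"

definition line_of_nuclei :: "('a::field, 4) point set" where
  "line_of_nuclei = zero_set {X 0, X 2}"


section \<open>The Klein quadric and parabolic linear congruences\<close>

datatype pindex = P01 | P02 | P03 | P12 | P13 | P23

instance pindex :: finite
proof
  have "(UNIV :: pindex set) = {P01, P02, P03, P12, P13, P23}"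
    using pindex.exhaust by auto
  then show "finite (UNIV :: pindex set)"
    by (metis finite.emptyI finite.insertI)
qed

abbreviation Y :: "pindex \<Rightarrow> (pindex, 'a::field) mpoly" where
  "Y \<equiv> indet"

definition pluecker :: "'a::field ^ 4 \<Rightarrow> 'a ^ 4 \<Rightarrow> 'a ^ pindex" where
  "pluecker p q = (\<chi> k. let y = (\<lambda>i j. p $ i * q $ j - p $ j * q $ i) in
     case k of P01 \<Rightarrow> y 0 1 | P02 \<Rightarrow> y 0 2 | P03 \<Rightarrow> y 0 3
             | P12 \<Rightarrow> y 1 2 | P13 \<Rightarrow> y 1 3 | P23 \<Rightarrow> y 2 3)"

text \<open>Meaningful for lines only.\<close>

definition klein :: "('a::field, 4) point set \<Rightarrow> ('a, pindex) point" where
  "klein l = (THE W. \<exists>p q. l = join p q \<and> W = pt (pluecker p q))"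

definition klein_poly :: "(pindex, 'a::field) mpoly" where
  "klein_poly = Y P01 * Y P23 - Y P02 * Y P13 + Y P03 * Y P12"

definition klein_quadric :: "('a::field, pindex) point set" where
  "klein_quadric = zero_set {klein_poly}"

definition perp :: "('a::field, pindex) point set \<Rightarrow> ('a, pindex) point set" where
  "perp S = {W. is_point W \<and> (\<forall>V\<in>S. \<forall>x\<in>V. \<forall>y\<in>W. polar_form klein_poly x y = 0)}"

definition tangent_of_klein_quadric :: "('a::field, pindex) point set \<Rightarrow> bool" where
  "tangent_of_klein_quadric l \<longleftrightarrow>
     is_line l \<and> (\<exists>V \<in> l \<inter> klein_quadric. l \<subseteq> perp {V})"

definition parabolic_solid :: "('a::field, pindex) point set \<Rightarrow> bool" where
  "parabolic_solid D \<longleftrightarrow>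
     is_proj_subspace 3 D \<and> tangent_of_klein_quadric (perp D) \<and> \<not> perp D \<subseteq> klein_quadric"

definition parabolic_linear_congruence :: "('a::field, 4) point set set \<Rightarrow> bool" where
  "parabolic_linear_congruence N \<longleftrightarrow>
     (\<forall>l\<in>N. is_line l) \<and> (\<exists>D. parabolic_solid D \<and> klein ` N = klein_quadric \<inter> D)"

text \<open>The line whose Klein image is the vertex of the cone \<open>klein ` N\<close>; meaningful for
  parabolic linear congruences only.\<close>

definition congruence_axis :: "('a::field, 4) point set set \<Rightarrow> ('a, 4) point set" where
  "congruence_axis N = (THE a. is_line a \<and>
     (\<exists>D. parabolic_solid D \<and> klein ` N = klein_quadric \<inter> D \<and>
          perp D \<inter> klein_quadric = {klein a}))"

end

theory Submission
  imports Defs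
begin

text \<open>
  In characteristic \<open>3\<close> the conditions \<open>T\<^sup>3 dvd f(p + T q)\<close> at a simple point \<open>p\<close> become
  \<open>p\<^sub>0 y\<^sub>0\<^sub>3 = p\<^sub>2 y\<^sub>0\<^sub>1 + p\<^sub>1 y\<^sub>0\<^sub>2\<close> and \<open>y\<^sub>0\<^sub>1 y\<^sub>0\<^sub>2 = 0\<close> in Pluecker coordinates. The case \<open>y\<^sub>0\<^sub>1 = 0\<close>
  gives the generators, the case \<open>y\<^sub>0\<^sub>2 = 0\<close> implies \<open>y\<^sub>0\<^sub>3 + y\<^sub>1\<^sub>2 = 0\<close>. Conversely a line with
  \<open>y\<^sub>0\<^sub>2 = y\<^sub>0\<^sub>3 + y\<^sub>1\<^sub>2 = 0\<close> belongs to the pencil if \<open>y\<^sub>0\<^sub>1 = 0\<close>; otherwise it joins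
  \<open>(1, 0, c, -d)\<close> and \<open>(0, 1, 0, c)\<close>, and its point \<open>(1, u, c, u c - d)\<close> lies on the surface
  iff \<open>u\<^sup>3 = d\<close>.
\<close>

section \<open>Coordinates in \<open>K^4\<close> and \<open>K^6\<close>\<close>

lemma UNIV4: "(UNIV :: 4 set) = {0, 1, 2, 3}"
proof -
  \<comment> \<open>\<open>exhaust_4\<close> lists the elements as 1, 2, 3, 4; in this cyclic type
    the last one is the index 0.\<close>
  have "(4::4) = 0" by simp
  then have "i \<in> {0, 1, 2, 3}" for i :: 4
    using exhaust_4[of i] by auto
  then show ?thesis
    by auto
qed

lemma distinct4:
  "(0::4) \<noteq> 1" "(0::4) \<noteq> 2" "(0::4) \<noteq> 3" "(1::4) \<noteq> 2" "(1::4) \<noteq> 3" "(2::4) \<noteq> 3"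
  by simp_all

lemma prod_UNIV4: "(\<Prod>i\<in>UNIV. g i) = g 0 * g 1 * g 2 * g (3::4)"
  unfolding UNIV4 by (simp add: mult.assoc)

lemma UNIV_pindex: "UNIV = {P01, P02, P03, P12, P13, P23}"
  using pindex.exhaust by auto

lemma vec4_nth [simp]:
  "vec4 a b c d $ 0 = a" "vec4 a b c d $ 1 = b" "vec4 a b c d $ 2 = c" "vec4 a b c d $ 3 = d"
  by (simp_all add: vec4_def)

lemma vec4_eq_iff: "x = y \<longleftrightarrow> x $ 0 = y $ 0 \<and> x $ 1 = y $ 1 \<and> x $ 2 = y $ 2 \<and> x $ 3 = y $ (3::4)"
  by (simp add: vec_eq_iff UNIV4 flip: ball_UNIV)

definition vec6 :: "'a \<Rightarrow> 'a \<Rightarrow> 'a \<Rightarrow> 'a \<Rightarrow> 'a \<Rightarrow> 'a \<Rightarrow> 'a ^ pindex" where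
  "vec6 a b c d e f = (\<chi> k. case k of P01 \<Rightarrow> a | P02 \<Rightarrow> b | P03 \<Rightarrow> c | P12 \<Rightarrow> d | P13 \<Rightarrow> e | P23 \<Rightarrow> f)"

lemma vec6_nth [simp]:
  "vec6 a b c d e f $ P01 = a" "vec6 a b c d e f $ P02 = b" "vec6 a b c d e f $ P03 = c"
  "vec6 a b c d e f $ P12 = d" "vec6 a b c d e f $ P13 = e" "vec6 a b c d e f $ P23 = f"
  by (simp_all add: vec6_def)

lemma vec6_eq_iff: "x = y \<longleftrightarrow> x $ P01 = y $ P01 \<and> x $ P02 = y $ P02 \<and> x $ P03 = y $ P03 \<and>
    x $ P12 = y $ P12 \<and> x $ P13 = y $ P13 \<and> x $ P23 = y $ P23"
  by (simp add: vec_eq_iff UNIV_pindex flip: ball_UNIV)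

lemma pluecker_nth [simp]:
  "pluecker p q $ P01 = p $ 0 * q $ 1 - p $ 1 * q $ 0"
  "pluecker p q $ P02 = p $ 0 * q $ 2 - p $ 2 * q $ 0"
  "pluecker p q $ P03 = p $ 0 * q $ 3 - p $ 3 * q $ 0"
  "pluecker p q $ P12 = p $ 1 * q $ 2 - p $ 2 * q $ 1"
  "pluecker p q $ P13 = p $ 1 * q $ 3 - p $ 3 * q $ 1"
  "pluecker p q $ P23 = p $ 2 * q $ 3 - p $ 3 * q $ 2"
  by (simp_all add: pluecker_def Let_def)

section \<open>Values of the polynomials\<close>

text \<open>Cancellation may remove keys from the sum \<open>f + g\<close>; since
  \<open>h 0 = 0\<close>, the lost keys contribute nothing.\<close>

lemma subst_poly_add:
  assumes "h 0 = 0" "\<And>a b. h (a + b) = h a + h b"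
  shows "subst_poly h v (f + g) = subst_poly h v f + subst_poly h v g"
  unfolding subst_poly_def
  by (rule setsum_keys_plus_distrib) (simp_all add: assms distrib_right)

lemma subst_poly_single:
  assumes "h 0 = 0"
  shows "subst_poly h v (Poly_Mapping.single m c) = h c * (\<Prod>i\<in>UNIV. v i ^ Poly_Mapping.lookup m i)"
  unfolding subst_poly_def by (cases "c = 0") (simp_all add: assms)

lemma partial_deriv_add:
  "partial_deriv i (f + g) = partial_deriv i f + partial_deriv i g"
  unfolding partial_deriv_def
  by (rule setsum_keys_plus_distrib) (simp_all add: distrib_left single_add)

lemma partial_deriv_single:
  "partial_deriv i (Poly_Mapping.single m c) =
    Poly_Mapping.single (m - Poly_Mapping.single i 1) (of_nat (Poly_Mapping.lookup m i) * c)"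
  unfolding partial_deriv_def by (cases "c = 0") simp_all

text \<open>As a sum of \<open>single\<close> terms the polynomial can be evaluated, restricted and
  differentiated term by term with the additivity lemmas.\<close>

lemma cayley_poly_monomials:
  "(cayley_poly :: (4, 'a::field) mpoly) =
     Poly_Mapping.single (Poly_Mapping.single 0 1 + Poly_Mapping.single 1 1 + Poly_Mapping.single 2 1) 1
   + Poly_Mapping.single (Poly_Mapping.single 1 3) (- 1)
   + Poly_Mapping.single (Poly_Mapping.single 0 2 + Poly_Mapping.single 3 1) (- 1)"
proof -
  have "Poly_Mapping.single 1 1 + Poly_Mapping.single 1 1 + Poly_Mapping.single 1 1 = Poly_Mapping.single (1::4) (3::nat)"
    and "Poly_Mapping.single 0 1 + Poly_Mapping.single 0 1 = Poly_Mapping.single (0::4) (2::nat)"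
    by (simp_all only: single_add [symmetric] one_add_one numeral_plus_one) (simp_all only: add_num_simps)
  then show ?thesis
    by (simp only: cayley_poly_def indet_def mult_single power2_eq_square power3_eq_cube
      single_uminus mult_1_right diff_conv_add_uminus)
qed

lemma klein_poly_monomials:
  "(klein_poly :: (pindex, 'a::field) mpoly) =
     Poly_Mapping.single (Poly_Mapping.single P01 1 + Poly_Mapping.single P23 1) 1
   + Poly_Mapping.single (Poly_Mapping.single P02 1 + Poly_Mapping.single P13 1) (- 1)
   + Poly_Mapping.single (Poly_Mapping.single P03 1 + Poly_Mapping.single P12 1) 1"
  unfolding klein_poly_def indet_def
  by (simp add: mult_single single_uminus)

lemma eval_poly_add: "eval_poly (f + g) x = eval_poly f x + eval_poly g x"
  by (simp add: eval_poly_def subst_poly_add)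

lemma eval_indet: "eval_poly (indet i :: ('i::finite, 'a::field) mpoly) x = x $ i"
proof -
  have "(\<Prod>j\<in>UNIV. x $ j ^ Poly_Mapping.lookup (Poly_Mapping.single i 1) j) = (\<Prod>j\<in>UNIV. if j = i then x $ j else 1)"
    by (rule prod.cong) (auto simp: lookup_single when_def)
  then show ?thesis
    by (simp add: eval_poly_def indet_def subst_poly_single)
qed

lemmas subst_poly_simps = subst_poly_add subst_poly_single

lemmas lookup_simps = lookup_add lookup_minus lookup_single when_def

lemma eval_klein:
  "eval_poly klein_poly x = x $ P01 * x $ P23 - x $ P02 * x $ P13 + x $ P03 * x $ P12"
  by (simp add: eval_poly_def klein_poly_monomials subst_poly_simps lookup_simps UNIV_pindex)

text \<open>The index \<open>0 :: 4\<close> is also the zero of its type, so \<open>single_one\<close> and \<open>single_numeral\<close>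
  would rewrite exponent vectors such as \<open>single 0 2\<close> to numerals.\<close>

lemma eval_cayley:
  "eval_poly cayley_poly x = x $ 0 * x $ 1 * x $ 2 - x $ 1 ^ 3 - x $ 0 ^ 2 * x $ 3"
  by (simp add: eval_poly_def cayley_poly_monomials subst_poly_simps prod_UNIV4
      del: One_nat_def single_one single_numeral,
      simp only: lookup_simps distinct4 distinct4 [symmetric], simp)

lemma eval_partial_deriv_cayley:
  fixes x :: "'a::field ^ 4"
  shows
  "eval_poly (partial_deriv 0 cayley_poly) x = x $ 1 * x $ 2 - 2 * x $ 0 * x $ 3"
  "eval_poly (partial_deriv 1 cayley_poly) x = x $ 0 * x $ 2 - 3 * x $ 1 ^ 2"
  "eval_poly (partial_deriv 2 cayley_poly) x = x $ 0 * x $ 1"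
  "eval_poly (partial_deriv 3 cayley_poly) x = - (x $ 0 ^ 2)"
  by (simp_all add: eval_poly_def cayley_poly_monomials partial_deriv_add partial_deriv_single
      subst_poly_simps prod_UNIV4
      del: One_nat_def single_one single_numeral,
    simp_all only: lookup_simps distinct4 distinct4 [symmetric], simp_all)

lemma restrict_cayley:
  "restrict_to_line cayley_poly p q =
    [:p $ 0, q $ 0:] * [:p $ 1, q $ 1:] * [:p $ 2, q $ 2:] - [:p $ 1, q $ 1:] ^ 3
     - [:p $ 0, q $ 0:] ^ 2 * [:p $ 3, q $ 3:]"
  by (simp add: restrict_to_line_def cayley_poly_monomials subst_poly_simps prod_UNIV4
      del: One_nat_def single_one single_numeral,
      simp only: lookup_simps distinct4 distinct4 [symmetric], simp)

text \<open>Divisibility by T^3 means that the coefficients of 1, T and T^2 vanish; the three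
  equations are these coefficients, valid in every characteristic.\<close>

lemma monom_3_dvd_restrict_cayley:
  fixes p q :: "'a::field ^ 4"
  shows "monom 1 3 dvd restrict_to_line cayley_poly p q \<longleftrightarrow>
    p $ 0 * p $ 1 * p $ 2 - p $ 1 ^ 3 - p $ 0 ^ 2 * p $ 3 = 0 \<and>
    q $ 0 * p $ 1 * p $ 2 + p $ 0 * q $ 1 * p $ 2 + p $ 0 * p $ 1 * q $ 2 - 3 * p $ 1 ^ 2 * q $ 1
      - 2 * p $ 0 * q $ 0 * p $ 3 - p $ 0 ^ 2 * q $ 3 = 0 \<and>
    p $ 0 * q $ 1 * q $ 2 + q $ 0 * p $ 1 * q $ 2 + q $ 0 * q $ 1 * p $ 2 - 3 * p $ 1 * q $ 1 ^ 2
      - 2 * p $ 0 * q $ 0 * q $ 3 - q $ 0 ^ 2 * p $ 3 = 0"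
proof -
  have less3: "(\<forall>k<3. Q k) \<longleftrightarrow> Q 0 \<and> Q 1 \<and> Q (2::nat)" for Q
    by (auto simp: numeral_eq_Suc less_Suc_eq)
  show ?thesis
    unfolding monom_1_dvd_iff' less3 restrict_cayley
    by (simp add: numeral_2_eq_2 power2_eq_square power3_eq_cube algebra_simps)
qed

lemma polar_form_klein:
  "polar_form klein_poly x y = x $ P01 * y $ P23 + x $ P23 * y $ P01
     - x $ P02 * y $ P13 - x $ P13 * y $ P02 + x $ P03 * y $ P12 + x $ P12 * y $ P03"
  by (simp add: polar_form_def eval_klein algebra_simps)

lemma homogeneous_klein_poly: "homogeneous_of_degree 2 (klein_poly :: (pindex, 'a::field) mpoly)"
  unfolding homogeneous_of_degree_def
proof
  fix m assume "m \<in> Poly_Mapping.keys (klein_poly :: (pindex, 'a) mpoly)"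
  then have "m \<in> {Poly_Mapping.single P01 1 + Poly_Mapping.single P23 1,
      Poly_Mapping.single P02 1 + Poly_Mapping.single P13 1,
      Poly_Mapping.single P03 1 + Poly_Mapping.single P12 1}"
    unfolding klein_poly_monomials
    by (auto dest!: set_mp[OF Poly_Mapping.keys_add] split: if_splits)
  then show "(\<Sum>i\<in>UNIV. Poly_Mapping.lookup m i) = 2"
    by (auto simp: UNIV_pindex lookup_add lookup_single when_def)
qed

section \<open>Subspaces and lines\<close>

lemma pt_eq: "pt x = range (\<lambda>c. c *s x)"
  by (simp add: pt_def vec.span_singleton)

lemma self_in_pt: "x \<in> pt x"
  by (simp add: pt_def vec.span_base)

lemma pt_subset_iff: "vec.subspace U \<Longrightarrow> pt x \<subseteq> U \<longleftrightarrow> x \<in> U"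
  by (metis pt_def self_in_pt subsetD vec.span_minimal empty_subsetI insert_subset)

lemma pt_scale: "c \<noteq> 0 \<Longrightarrow> pt (c *s x) = pt x"
  by (simp add: pt_def vec.span_image_scale[of "{x}" "\<lambda>_. c", simplified])

lemma is_point_pt: "x \<noteq> 0 \<Longrightarrow> is_point (pt x)"
  by (simp add: is_point_def pt_def vec.dim_eq_card_independent)

lemma is_pointE:
  assumes "is_point P"
  obtains x where "x \<noteq> 0" "P = pt x"
proof -
  have P: "vec.subspace P" "vec.dim P = 1"
    using assms by (auto simp: is_point_def)
  obtain B where B: "B \<subseteq> P" "vec.independent B" "P \<subseteq> vec.span B" "card B = 1"
    using vec.basis_exists[of P] P(2) by metis
  then obtain x where "B = {x}"
    by (auto simp: card_1_singleton_iff)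
  with B have "x \<noteq> 0"
    by auto
  moreover have "P = pt x"
    using B \<open>B = {x}\<close> pt_subset_iff[OF P(1)] by (auto simp: pt_def)
  ultimately show thesis by (rule that)
qed

lemma pt_in_points_of: "vec.subspace U \<Longrightarrow> x \<noteq> 0 \<Longrightarrow> pt x \<in> points_of U \<longleftrightarrow> x \<in> U"
  by (simp add: points_of_def is_point_pt pt_subset_iff)

lemma points_of_E:
  assumes "P \<in> points_of U"
  obtains x where "x \<noteq> 0" "P = pt x" "x \<in> U"
  using assms is_pointE self_in_pt unfolding points_of_def by blast

lemma points_of_subset_iff:
  assumes "vec.subspace U" "vec.subspace V"
  shows "points_of U \<subseteq> points_of V \<longleftrightarrow> U \<subseteq> V"
proof
  assume sub: "points_of U \<subseteq> points_of V"
  show "U \<subseteq> V"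
  proof
    fix x assume "x \<in> U"
    then show "x \<in> V"
      using sub assms pt_in_points_of[of _ x] vec.subspace_0[of V] by (cases "x = 0") auto
  qed
qed (auto simp: points_of_def)

lemma points_of_eq_iff:
  "vec.subspace U \<Longrightarrow> vec.subspace V \<Longrightarrow> points_of U = points_of V \<longleftrightarrow> U = V"
  by (simp add: set_eq_subset points_of_subset_iff)

lemma Union_points_of:
  assumes "vec.subspace U" "x \<in> U" "x \<noteq> 0"
  shows "x \<in> \<Union>(points_of U)"
  using assms pt_in_points_of self_in_pt by blast

text \<open>A subspace is determined by its points, so the subspace hidden in
  \<open>is_proj_subspace\<close> can only be \<open>U\<close>.\<close>

lemma is_proj_subspace_points_of:
  "vec.subspace U \<Longrightarrow> is_proj_subspace d (points_of U) \<longleftrightarrow> vec.dim U = d + 1"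
  unfolding is_proj_subspace_def using points_of_eq_iff by blast

lemma zero_set_eq_points_of: "zero_set G = points_of {x. \<forall>g\<in>G. eval_poly g x = 0}"
  by (auto simp: zero_set_def points_of_def)

text \<open>The vectors \<open>b j\<close> are dual to the coordinates in \<open>J\<close>: reading
  coordinate \<open>k\<close> of a vanishing combination gives independence, and \<open>gen\<close>
  says that they span.\<close>

lemma dim_by_coordinates:
  fixes b :: "'n::finite \<Rightarrow> 'a::field ^ 'n"
  assumes U: "vec.subspace U"
    and b: "\<And>j. j \<in> J \<Longrightarrow> b j \<in> U" "\<And>j k. j \<in> J \<Longrightarrow> k \<in> J \<Longrightarrow> b j $ k = (if j = k then 1 else 0)"
    and gen: "\<And>x. x \<in> U \<Longrightarrow> x = (\<Sum>j\<in>J. x $ j *s b j)"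
  shows "vec.dim U = card J"
proof -
  have inj: "inj_on b J"
    by (rule inj_onI) (metis b(2) one_neq_zero)
  have "vec.independent (b ` J)"
  proof (rule vec.independent_if_scalars_zero)
    fix f x assume sum: "(\<Sum>x\<in>b ` J. f x *s x) = 0" and "x \<in> b ` J"
    then obtain k where k: "k \<in> J" "x = b k" by blast
    have "0 = (\<Sum>j\<in>J. f (b j) *s b j) $ k"
      using sum by (simp add: sum.reindex[OF inj])
    also have "\<dots> = (\<Sum>j\<in>J. if j = k then f (b k) else 0)"
      unfolding sum_component by (rule sum.cong) (use k in \<open>auto simp: b(2)\<close>)
    also have "\<dots> = f (b k)"
      using k by simp
    finally show "f x = 0" by (simp add: k)
  qed simp
  moreover have "U \<subseteq> vec.span (b ` J)"
  proof
    fix x assume "x \<in> U"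
    then have "x = (\<Sum>j\<in>J. x $ j *s b j)" by (rule gen)
    also have "\<dots> \<in> vec.span (b ` J)"
      by (intro vec.span_sum vec.span_scale vec.span_base imageI)
    finally show "x \<in> vec.span (b ` J)" .
  qed
  ultimately show ?thesis
    using vec.dim_unique[of "b ` J" U "card J"] b(1) inj by (auto simp: card_image)
qed

section \<open>Lines of projective 3-space and their Pluecker coordinates\<close>

lemma in_span_pair: "x \<in> vec.span {p, q} \<longleftrightarrow> (\<exists>a b. x = a *s p + b *s q)"
proof -
  have "x \<in> vec.span {p, q} \<longleftrightarrow> (\<exists>a b. x - a *s p = b *s q)"
    by (auto simp: vec.span_breakdown_eq[of x p] vec.span_singleton)
  then show ?thesis
    by (simp add: diff_eq_eq add.commute)
qed

text \<open>Pluecker coordinates are 2x2 minors, hence alternating and bilinear; the factor is the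
  determinant of the change of spanning vectors.\<close>

lemma pluecker_combination:
  "pluecker (a *s p + b *s q) (c *s p + d *s q) = (a * d - b * c) *s pluecker p q"
  by (simp add: vec6_eq_iff algebra_simps)

lemma pluecker_eq_0_iff: "pluecker p q = 0 \<longleftrightarrow> (\<forall>i j. p $ i * q $ j = p $ j * q $ i)"
proof -
  have "(\<forall>i j. p $ i * q $ j = p $ j * q $ i) \<longleftrightarrow>
      (\<forall>i\<in>{0, 1, 2, 3}. \<forall>j\<in>{0, 1, 2, 3}. p $ i * q $ j = p $ j * q $ i)"
    unfolding UNIV4[symmetric] by simp
  then show ?thesis
    by (auto simp: vec6_eq_iff)
qed

lemma independent_pair:
  assumes "pluecker p q \<noteq> 0"
  shows "vec.independent {p, q}" "p \<noteq> q"
proof -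
  have "q \<noteq> 0"
    using assms by (auto simp: pluecker_eq_0_iff)
  moreover have "p \<notin> vec.span {q}"
    using assms by (auto simp: pluecker_eq_0_iff vec.span_singleton)
  ultimately show "vec.independent {p, q}"
    using vec.independent_insertI[of p "{q}"] by simp
  show "p \<noteq> q"
    using assms by (auto simp: pluecker_eq_0_iff)
qed

lemma is_line_join: "is_line (join p q) \<longleftrightarrow> pluecker p q \<noteq> 0"
proof -
  have "vec.dim {p, q} = 2 \<longleftrightarrow> pluecker p q \<noteq> 0"
  proof
    assume dim: "vec.dim {p, q} = 2"
    show "pluecker p q \<noteq> 0"
    proof
      assume "pluecker p q = 0"
      then have eq: "p $ i * q $ j = p $ j * q $ i" for i j
        by (simp add: pluecker_eq_0_iff)
      have "\<exists>r. {p, q} \<subseteq> vec.span {r}"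
      proof (cases "q = 0")
        case True
        then show ?thesis by (auto intro!: exI[of _ p] vec.span_base vec.span_zero)
      next
        case False
        \<comment> \<open>A nonzero coordinate of \<open>q\<close> and the vanishing minors exhibit
          \<open>p\<close> as a multiple of \<open>q\<close>.\<close>
        then obtain k where k: "q $ k \<noteq> 0"
          by (auto simp: vec_eq_iff)
        have "p = (p $ k / q $ k) *s q"
          using eq k by (simp add: vec_eq_iff field_simps)
        then have "p \<in> vec.span {q}"
          by (auto simp: vec.span_singleton)
        then show ?thesis by (auto intro!: exI[of _ q] vec.span_base)
      qed
      then obtain r where "{p, q} \<subseteq> vec.span {r}" ..
      then have "vec.dim {p, q} \<le> card {r}"
        by (rule vec.dim_le_card) simp
      with dim show False by simp
    qed
  next
    assume "pluecker p q \<noteq> 0"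
    then show "vec.dim {p, q} = 2"
      using independent_pair[of p q] by (simp add: vec.dim_eq_card_independent)
  qed
  then show ?thesis
    by (simp add: is_line_def join_def is_proj_subspace_points_of numeral_2_eq_2)
qed

lemma is_lineE:
  fixes l :: "('a::field, 4) point set"
  assumes "is_line l"
  obtains p q where "l = join p q" "pluecker p q \<noteq> 0"
proof -
  obtain U where U: "vec.subspace U" "vec.dim U = 2" "l = points_of U"
    using assms by (auto simp: is_line_def is_proj_subspace_def numeral_2_eq_2)
  obtain B where B: "B \<subseteq> U" "U \<subseteq> vec.span B" "card B = 2"
    using vec.basis_exists[of U] U(2) by metis
  then obtain p q where "B = {p, q}"
    by (auto simp: card_2_iff)
  with B U have "l = join p q"
    by (simp add: join_def) (metis antisym insert_subset vec.span_minimal empty_subsetI)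
  with assms that show thesis
    by (simp add: is_line_join)
qed

text \<open>The nonzero minors of \<open>p, q\<close> force \<open>p', q'\<close> to be independent
  too, so the inclusion of the spans is one between spaces of dimension 2.\<close>

lemma join_eqI:
  assumes "pluecker p q \<noteq> 0" "p = a *s p' + b *s q'" "q = c *s p' + d *s q'"
  shows "join p q = join p' q'"
proof -
  have pl: "pluecker p' q' \<noteq> 0"
    using assms(1) pluecker_combination[of a p' b q' c d] by (auto simp: assms(2,3))
  have "vec.span {p, q} \<subseteq> vec.span {p', q'}"
    by (rule vec.span_minimal) (auto simp: in_span_pair assms(2,3))
  moreover have "vec.dim {p, q} = 2" "vec.dim {p', q'} = 2"
    using pl assms(1) independent_pair[of p q] independent_pair[of p' q']
    by (simp_all add: vec.dim_eq_card_independent)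
  ultimately have "vec.span {p, q} = vec.span {p', q'}"
    by (intro vec.subspace_dim_equal) simp_all
  then show ?thesis by (simp add: join_def)
qed

lemma join_eqD:
  assumes "join p q = join p' q'"
  obtains a b c d where "p = a *s p' + b *s q'" "q = c *s p' + d *s q'"
proof -
  have "vec.span {p, q} = vec.span {p', q'}"
    using assms by (simp add: join_def points_of_eq_iff)
  then have "p \<in> vec.span {p', q'}" "q \<in> vec.span {p', q'}"
    using vec.span_base[of _ "{p, q}"] by auto
  with that show thesis
    by (auto simp: in_span_pair)
qed

text \<open>Another spanning pair rescales the Pluecker vector by a determinant, which is nonzero
  because \<open>pluecker p q\<close> is; so the description in \<open>klein\<close> is
  unambiguous.\<close>

lemma klein_join:
  assumes "pluecker p q \<noteq> 0"
  shows "klein (join p q) = pt (pluecker p q)"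
  unfolding klein_def
proof (rule the_equality)
  fix W assume "\<exists>p' q'. join p q = join p' q' \<and> W = pt (pluecker p' q')"
  then obtain p' q' where eq: "join p q = join p' q'" and W: "W = pt (pluecker p' q')" by blast
  from eq obtain a b c d where "p = a *s p' + b *s q'" "q = c *s p' + d *s q'"
    by (rule join_eqD)
  then have "pluecker p q = (a * d - b * c) *s pluecker p' q'"
    by (simp add: pluecker_combination)
  with assms show "W = pt (pluecker p q)"
    unfolding W by (metis pt_scale vec.scale_eq_0_iff)
qed blast

lemma pt_in_join: "x \<noteq> 0 \<Longrightarrow> pt x \<in> join p q \<longleftrightarrow> (\<exists>a b. x = a *s p + b *s q)"
  by (simp add: join_def pt_in_points_of in_span_pair)

section \<open>The parabolic solid\<close>

definition solid_vecs :: "('a::field ^ pindex) set" where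
  "solid_vecs = {y. y $ P02 = 0 \<and> y $ P03 + y $ P12 = 0}"

text \<open>The vector space of the line \<open>perp D\<close>, as \<open>perp_solid\<close>
  shows.\<close>

definition tangent_vecs :: "('a::field ^ pindex) set" where
  "tangent_vecs = {y. y $ P01 = 0 \<and> y $ P02 = 0 \<and> y $ P23 = 0 \<and> y $ P03 = y $ P12}"

lemma subspace_solid_vecs: "vec.subspace solid_vecs"
  by (auto simp: vec.subspace_def solid_vecs_def algebra_simps) (simp flip: distrib_left)

lemma subspace_tangent_vecs: "vec.subspace tangent_vecs"
  by (auto simp: vec.subspace_def tangent_vecs_def algebra_simps)

lemma dim_solid_vecs: "vec.dim (solid_vecs :: ('a::field ^ pindex) set) = 4"
proof -
  \<comment> \<open>The vector for \<open>P03\<close> carries -1 at \<open>P12\<close> to stay in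
    the solid; the default branch serves \<open>P23\<close>.\<close>
  let ?b = "\<lambda>j. case j of P01 \<Rightarrow> vec6 1 0 0 0 0 0 | P03 \<Rightarrow> vec6 0 0 1 (- 1) 0 0
    | P13 \<Rightarrow> vec6 0 0 0 0 1 0 | _ \<Rightarrow> vec6 0 0 0 0 0 (1::'a)"
  have "vec.dim (solid_vecs :: ('a ^ pindex) set) = card {P01, P03, P13, P23}"
    by (rule dim_by_coordinates[OF subspace_solid_vecs, where b = ?b])
      (auto simp: solid_vecs_def vec6_eq_iff eq_neg_iff_add_eq_0 add.commute)
  then show ?thesis by simp
qed

lemma dim_tangent_vecs: "vec.dim (tangent_vecs :: ('a::field ^ pindex) set) = 2"
proof -
  let ?b = "\<lambda>j. case j of P03 \<Rightarrow> vec6 0 0 1 1 0 0 | _ \<Rightarrow> vec6 0 0 0 0 (1::'a) 0"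
  have "vec.dim (tangent_vecs :: ('a ^ pindex) set) = card {P03, P13}"
    by (rule dim_by_coordinates[OF subspace_tangent_vecs, where b = ?b])
      (auto simp: tangent_vecs_def vec6_eq_iff)
  then show ?thesis by simp
qed

lemma solid_eq: "zero_set {Y P02, Y P03 + Y P12} = points_of solid_vecs"
  by (simp add: zero_set_eq_points_of eval_poly_add eval_indet solid_vecs_def)

lemma is_proj_subspace_solid: "is_proj_subspace 3 (points_of solid_vecs)"
  by (simp add: is_proj_subspace_points_of subspace_solid_vecs dim_solid_vecs)

lemma pt_in_klein_quadric:
  assumes "y \<noteq> 0"
  shows "pt y \<in> klein_quadric \<longleftrightarrow> y $ P01 * y $ P23 - y $ P02 * y $ P13 + y $ P03 * y $ P12 = 0"
proof -
  have "(c *s y) $ P01 * (c *s y) $ P23 - (c *s y) $ P02 * (c *s y) $ P13 + (c *s y) $ P03 * (c *s y) $ P12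
      = c\<^sup>2 * (y $ P01 * y $ P23 - y $ P02 * y $ P13 + y $ P03 * y $ P12)" for c
    by (simp add: algebra_simps power2_eq_square)
  then have "(\<forall>x\<in>pt y. eval_poly klein_poly x = 0) \<longleftrightarrow>
      y $ P01 * y $ P23 - y $ P02 * y $ P13 + y $ P03 * y $ P12 = 0"
    using self_in_pt[of y] by (auto simp: eval_klein pt_eq simp del: vector_smult_component)
  then show ?thesis
    by (simp add: klein_quadric_def zero_set_def is_point_pt assms)
qed

text \<open>Reduces the polarity to linear algebra: points supply all nonzero vectors of
  \<open>U\<close>, and the zero vector is orthogonal to everything.\<close>

lemma perp_points_of:
  assumes "vec.subspace U"
  shows "perp (points_of U) = points_of {y. \<forall>x\<in>U. polar_form klein_poly x y = 0}"
proof -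
  have "(\<forall>V\<in>points_of U. \<forall>x\<in>V. \<forall>y\<in>W. polar_form klein_poly x y = 0) \<longleftrightarrow>
      W \<subseteq> {y. \<forall>x\<in>U. polar_form klein_poly x y = 0}" (is "?l \<longleftrightarrow> ?r") for W
  proof
    assume l: ?l
    show ?r
    proof clarify
      fix x y assume xy: "y \<in> W" "x \<in> U"
      show "polar_form klein_poly x y = 0"
      proof (cases "x = 0")
        case True
        then show ?thesis by (simp add: polar_form_klein)
      next
        case False
        then show ?thesis
          using l xy assms pt_in_points_of self_in_pt by blast
      qed
    qed
  qed (auto simp: points_of_def)
  then show ?thesis
    by (auto simp: perp_def points_of_def)
qed

lemma perp_solid: "perp (points_of solid_vecs) = points_of (tangent_vecs :: ('a::field ^ pindex) set)"
proof -
  have "{y. \<forall>x\<in>solid_vecs. polar_form klein_poly x y = 0} = (tangent_vecs :: ('a ^ pindex) set)"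
  proof (intro equalityI subsetI; clarify?)
    fix y :: "'a ^ pindex"
    assume *: "\<forall>x\<in>solid_vecs. polar_form klein_poly x y = 0"
    show "y \<in> tangent_vecs"
      \<comment> \<open>These four vectors form a basis of the solid; in turn they give
        \<open>y\<^sub>2\<^sub>3 = 0\<close>, \<open>y\<^sub>0\<^sub>1 = 0\<close>,
        \<open>y\<^sub>0\<^sub>2 = 0\<close> and
        \<open>y\<^sub>1\<^sub>2 = y\<^sub>0\<^sub>3\<close>.\<close>
      using *[rule_format, of "vec6 1 0 0 0 0 0"] *[rule_format, of "vec6 0 0 0 0 0 1"]
        *[rule_format, of "vec6 0 0 0 0 1 0"] *[rule_format, of "vec6 0 0 1 (- 1) 0 0"]
      by (auto simp: polar_form_klein solid_vecs_def tangent_vecs_def)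
  next
    fix x y :: "'a ^ pindex"
    assume "y \<in> tangent_vecs" "x \<in> solid_vecs"
    then show "polar_form klein_poly x y = 0"
      by (auto simp: polar_form_klein solid_vecs_def tangent_vecs_def simp flip: distrib_right)
  qed
  then show ?thesis
    by (simp add: perp_points_of subspace_solid_vecs)
qed

text \<open>On \<open>tangent_vecs\<close> the Klein form reduces to the square of the coordinate
  \<open>P03\<close>, so it has a single zero on this line.\<close>

lemma perp_solid_Int_klein_quadric:
  "points_of tangent_vecs \<inter> klein_quadric = {pt (vec6 0 0 0 0 1 0 :: 'a::field ^ pindex)}"
proof (intro equalityI subsetI)
  fix P :: "('a, pindex) point"
  assume P: "P \<in> points_of tangent_vecs \<inter> klein_quadric"
  then obtain y where y: "y \<noteq> 0" "P = pt y" "y \<in> tangent_vecs"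
    by (blast elim: points_of_E)
  with P have "y $ P03 = 0"
    by (auto simp: pt_in_klein_quadric tangent_vecs_def)
  with y have "y = y $ P13 *s vec6 0 0 0 0 1 0" "y $ P13 \<noteq> 0"
    by (auto simp: vec6_eq_iff tangent_vecs_def)
  then show "P \<in> {pt (vec6 0 0 0 0 1 0)}"
    using y(2) pt_scale by (metis singletonI)
qed (simp add: pt_in_points_of pt_in_klein_quadric subspace_tangent_vecs vec6_eq_iff, simp add: tangent_vecs_def)

text \<open>The line \<open>perp D\<close> is tangent at the point of \<open>?v\<close>: pairing
  with \<open>?v\<close> only sees the coordinate \<open>P02\<close>, which is 0 on
  \<open>tangent_vecs\<close>. The point of \<open>?w\<close> shows that the line leaves the
  quadric.\<close>

lemma parabolic_solid: "parabolic_solid (points_of (solid_vecs :: ('a::field ^ pindex) set))"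
proof -
  let ?v = "vec6 0 0 0 0 1 0 :: 'a ^ pindex"
  let ?w = "vec6 0 0 1 1 0 0 :: 'a ^ pindex"
  have "pt ?v \<in> points_of tangent_vecs \<inter> klein_quadric"
    by (simp add: perp_solid_Int_klein_quadric)
  moreover have "points_of tangent_vecs \<subseteq> perp {pt ?v}"
    by (auto simp: perp_def points_of_def polar_form_klein pt_eq tangent_vecs_def)
  ultimately have "tangent_of_klein_quadric (points_of (tangent_vecs :: ('a ^ pindex) set))"
    unfolding tangent_of_klein_quadric_def is_line_def
    by (auto simp: is_proj_subspace_points_of subspace_tangent_vecs dim_tangent_vecs)
  moreover have "pt ?w \<in> points_of tangent_vecs" "pt ?w \<notin> klein_quadric"
    by (simp_all add: pt_in_points_of pt_in_klein_quadric subspace_tangent_vecs vec6_eq_iff)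
      (simp add: tangent_vecs_def)
  ultimately show ?thesis
    unfolding parabolic_solid_def perp_solid using is_proj_subspace_solid by blast
qed

text \<open>The section of the Klein quadric spans the solid.\<close>

lemma solid_unique:
  fixes D :: "('a::field, pindex) point set"
  assumes "is_proj_subspace 3 D" "klein_quadric \<inter> points_of solid_vecs \<subseteq> D"
  shows "D = points_of solid_vecs"
proof -
  obtain U where U: "vec.subspace U" "vec.dim U = 4" "D = points_of U"
    using assms(1) by (auto simp: is_proj_subspace_def)
  have mem: "y \<in> U" if "y \<in> solid_vecs" "y \<noteq> 0"
      "y $ P01 * y $ P23 - y $ P02 * y $ P13 + y $ P03 * y $ P12 = 0" for y
    using that assms(2) U pt_in_points_of[of _ y] pt_in_klein_quadric[of y] subspace_solid_vecs by blast
  \<comment> \<open>A basis of the solid consisting of zeros of the Klein form; in the last vector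
    the contributions 1 and -1 cancel.\<close>
  have "vec6 1 0 0 0 0 0 \<in> U" "vec6 0 0 0 0 1 0 \<in> U" "vec6 0 0 0 0 0 1 \<in> U" "vec6 1 0 1 (- 1) 0 1 \<in> U"
    by (rule mem; simp add: solid_vecs_def vec6_eq_iff)+
  then have "(y $ P01 - y $ P03) *s vec6 1 0 0 0 0 0 + y $ P13 *s vec6 0 0 0 0 1 0
      + (y $ P23 - y $ P03) *s vec6 0 0 0 0 0 1 + y $ P03 *s vec6 1 0 1 (- 1) 0 1 \<in> U" for y
    using U(1) by (intro vec.subspace_add vec.subspace_scale)
  moreover have "y = (y $ P01 - y $ P03) *s vec6 1 0 0 0 0 0 + y $ P13 *s vec6 0 0 0 0 1 0
      + (y $ P23 - y $ P03) *s vec6 0 0 0 0 0 1 + y $ P03 *s vec6 1 0 1 (- 1) 0 1"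
    if "y \<in> solid_vecs" for y :: "'a ^ pindex"
    using that by (auto simp: vec6_eq_iff solid_vecs_def eq_neg_iff_add_eq_0 add.commute)
  ultimately have "solid_vecs \<subseteq> U"
    by (metis subsetI)
  then have "solid_vecs = U"
    using U by (intro vec.subspace_dim_equal) (auto simp: subspace_solid_vecs dim_solid_vecs)
  then show ?thesis by (simp add: U(3))
qed

text \<open>On the solid the Klein form is \<open>y\<^sub>0\<^sub>1 y\<^sub>2\<^sub>3 -
  y\<^sub>0\<^sub>3\<^sup>2\<close>, which does not involve the coordinate \<open>P13\<close>. So
  the vertex is the point of \<open>v\<close>, and the plane where that coordinate is 0 cuts out the
  base conic.\<close>

lemma quadratic_cone_klein_quadric_solid:
  assumes two: "(2::'a::field) \<noteq> 0"
  shows "quadratic_cone (klein_quadric \<inter> points_of (solid_vecs :: ('a ^ pindex) set))"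
proof -
  define v :: "'a ^ pindex" where "v = vec6 0 0 0 0 1 0"
  define plane :: "('a ^ pindex) set" where "plane = {y. y \<in> solid_vecs \<and> y $ P13 = 0}"
  define C where "C = points_of plane \<inter> zero_set {klein_poly}"
  have plane: "vec.subspace plane"
    using subspace_solid_vecs by (auto simp: plane_def vec.subspace_def)
  have dim: "vec.dim plane = 3"
  proof -
    let ?b = "\<lambda>j. case j of P01 \<Rightarrow> vec6 1 0 0 0 0 0 | P03 \<Rightarrow> vec6 0 0 1 (- 1) 0 0
      | _ \<Rightarrow> vec6 0 0 0 0 0 (1::'a)"
    have "vec.dim plane = card {P01, P03, P23}"
      by (rule dim_by_coordinates[OF plane, where b = ?b])
        (auto simp: solid_vecs_def plane_def vec6_eq_iff eq_neg_iff_add_eq_0 add.commute)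
    then show ?thesis by simp
  qed
  have v: "v \<noteq> 0"
    by (simp add: v_def vec6_eq_iff)
  have VE: "pt v \<notin> points_of plane"
    using v by (simp add: pt_in_points_of plane) (simp add: v_def plane_def)
  have e01: "pt (vec6 1 0 0 0 0 0) \<in> C"
    by (simp add: C_def pt_in_points_of plane vec6_eq_iff pt_in_klein_quadric
        flip: klein_quadric_def) (simp add: plane_def solid_vecs_def)
  have "x = 0" if "x \<in> \<Union>(points_of plane)"
    and orth: "\<forall>y\<in>\<Union>(points_of plane). polar_form klein_poly x y = 0" for x
  proof -
    have x: "x \<in> plane"
      using that(1) by (auto simp: points_of_def)
    have *: "polar_form klein_poly x y = 0" if "y \<in> plane" for y
    proof (cases "y = 0")
      case True
      then show ?thesis by (simp add: polar_form_klein)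
    next
      case False
      then show ?thesis
        using orth that Union_points_of[OF plane] by blast
    qed
    \<comment> \<open>Together with \<open>x\<^sub>0\<^sub>3 = - x\<^sub>1\<^sub>2\<close> this
      leaves twice a coordinate equal to 0; here characteristic 2 must be excluded.\<close>
    have "x $ P12 - x $ P03 = 0"
      using *[of "vec6 0 0 1 (- 1) 0 0"] by (simp add: plane_def solid_vecs_def polar_form_klein)
    moreover have "x $ P03 = - x $ P12"
      using x by (simp add: plane_def solid_vecs_def eq_neg_iff_add_eq_0)
    ultimately have "2 * x $ P12 = 0"
      by (metis diff_minus_eq_add mult_2)
    then have "x $ P12 = 0" "x $ P03 = 0"
      using two \<open>x $ P03 = - x $ P12\<close> by simp_all
    moreover have "x $ P23 = 0" "x $ P01 = 0"
      using *[of "vec6 1 0 0 0 0 0"] *[of "vec6 0 0 0 0 0 1"]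
      by (simp_all add: plane_def solid_vecs_def polar_form_klein)
    ultimately show ?thesis
      using x by (simp add: vec6_eq_iff plane_def solid_vecs_def)
  qed
  then have conic: "nondegenerate_conic (points_of plane) C"
    unfolding nondegenerate_conic_def using homogeneous_klein_poly e01 C_def by blast
  have cone_mem: "pt y \<in> points_of (vec.span (pt v \<union> pt x)) \<longleftrightarrow> (\<exists>a b. y = a *s v + b *s x)"
    if "y \<noteq> 0" for x y
  proof -
    have "vec.span (pt v \<union> pt x) = vec.span {v, x}"
      using vec.span_Un[of "{v}" "{x}"] by (simp only: pt_def vec.span_Un vec.span_span insert_is_Un [of v "{x}"])
    then show ?thesis
      using that by (simp add: pt_in_points_of in_span_pair)
  qed
  have "klein_quadric \<inter> points_of solid_vecs = (\<Union>X\<in>C. points_of (vec.span (pt v \<union> X)))"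
  proof (intro equalityI subsetI)
    fix P assume P: "P \<in> klein_quadric \<inter> points_of (solid_vecs :: ('a ^ pindex) set)"
    then obtain y where y: "y \<noteq> 0" "P = pt y" "y \<in> solid_vecs"
      by (blast elim: points_of_E)
    define z where "z = vec6 (y $ P01) 0 (y $ P03) (y $ P12) 0 (y $ P23)"
    have yz: "y = y $ P13 *s v + 1 *s z"
      using y(3) by (simp add: z_def v_def vec6_eq_iff solid_vecs_def)
    show "P \<in> (\<Union>X\<in>C. points_of (vec.span (pt v \<union> X)))"
    proof (cases "z = 0")
      case True
      \<comment> \<open>Here \<open>P\<close> is the vertex, which lies on the line to any point of
        the conic; \<open>e01\<close> provides such a point.\<close>
      then have "y = y $ P13 *s v + 0 *s vec6 1 0 0 0 0 0"
        using yz by simp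
      then show ?thesis
        using e01 cone_mem y(1,2) by blast
    next
      case False
      have "z \<in> plane"
        using y(3) by (simp add: z_def plane_def solid_vecs_def)
      moreover have "pt z \<in> klein_quadric"
        using P y False by (simp add: pt_in_klein_quadric) (simp add: z_def solid_vecs_def)
      ultimately have "pt z \<in> C"
        using False by (simp add: C_def pt_in_points_of plane klein_quadric_def)
      then show ?thesis
        using yz cone_mem y(1,2) by blast
    qed
  next
    fix P assume "P \<in> (\<Union>X\<in>C. points_of (vec.span (pt v \<union> X)))"
    then obtain X where X: "X \<in> C" and P: "P \<in> points_of (vec.span (pt v \<union> X))" by blast
    from X obtain x where x: "x \<noteq> 0" "X = pt x" "x \<in> plane"
      unfolding C_def by (blast elim: points_of_E)
    from P obtain y where y: "y \<noteq> 0" "P = pt y"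
      by (blast elim: points_of_E)
    with P x(2) cone_mem obtain a b where ab: "y = a *s v + b *s x" by blast
    have "x $ P01 * x $ P23 + x $ P03 * x $ P12 = 0"
      using X x pt_in_klein_quadric[of x] by (simp add: C_def klein_quadric_def plane_def solid_vecs_def)
    \<comment> \<open>The vertex contributes nothing, so the form at \<open>y\<close> is
      \<open>b * b\<close> times its value at \<open>x\<close>.\<close>
    then have "b * b * (x $ P01 * x $ P23 + x $ P03 * x $ P12) = 0"
      by simp
    then have "y $ P01 * y $ P23 - y $ P02 * y $ P13 + y $ P03 * y $ P12 = 0"
      using x(3) by (simp add: ab v_def plane_def solid_vecs_def algebra_simps)
    moreover have "y \<in> solid_vecs"
      using x(3) by (simp add: ab v_def plane_def solid_vecs_def flip: distrib_left)
    ultimately show "P \<in> klein_quadric \<inter> points_of solid_vecs"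
      using y by (simp add: pt_in_klein_quadric pt_in_points_of subspace_solid_vecs)
  qed
  moreover have "is_proj_subspace 2 (points_of plane)"
    using dim plane by (simp add: is_proj_subspace_points_of)
  ultimately show ?thesis
    unfolding quadratic_cone_def using is_point_pt[OF v] VE conic by blast
qed

section \<open>Osculating tangents\<close>

lemma g_inf_eq_join: "g_inf = join (vec4 0 0 1 0) (vec4 0 0 0 (1::'a::field))"
proof -
  have "vec.span {vec4 0 0 1 0, vec4 0 0 0 1} = {x :: 'a ^ 4. x $ 0 = 0 \<and> x $ 1 = 0}"
    by (auto simp: in_span_pair vec4_eq_iff)
  then show ?thesis
    by (simp add: g_inf_def zero_set_eq_points_of eval_indet join_def)
qed

lemma line_of_nuclei_eq_join: "line_of_nuclei = join (vec4 0 1 0 0) (vec4 0 0 0 (1::'a::field))"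
proof -
  have "vec.span {vec4 0 1 0 0, vec4 0 0 0 1} = {x :: 'a ^ 4. x $ 0 = 0 \<and> x $ 2 = 0}"
    by (auto simp: in_span_pair vec4_eq_iff)
  then show ?thesis
    by (simp add: line_of_nuclei_def zero_set_eq_points_of eval_indet join_def)
qed

lemma omega_eq: "omega = points_of {x. x $ 0 = 0}"
  by (simp add: omega_def zero_set_eq_points_of eval_indet)

lemma join_subset_omega_iff: "join p q \<subseteq> omega \<longleftrightarrow> p $ 0 = 0 \<and> q $ 0 = 0"
proof -
  have sub: "vec.subspace {x :: 'a::field ^ 4. x $ 0 = 0}"
    by (auto simp: vec.subspace_def)
  have "join p q \<subseteq> omega \<longleftrightarrow> {p, q} \<subseteq> {x. x $ 0 = 0}"
    unfolding join_def omega_eq points_of_subset_iff[OF vec.subspace_span sub]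
    using vec.span_minimal[OF _ sub, of "{p, q}"] vec.span_base[of _ "{p, q}"] by blast
  then show ?thesis by simp
qed

text \<open>Inside the plane, a line passes through Z iff the projections of \<open>p\<close> and
  \<open>q\<close> to the coordinates 1 and 2 are dependent.\<close>

lemma join_in_pencil:
  assumes "pluecker p q \<noteq> 0"
  shows "join p q \<in> pencil (pt (vec4 0 0 0 1)) omega \<longleftrightarrow>
    p $ 0 = 0 \<and> q $ 0 = 0 \<and> p $ 1 * q $ 2 = p $ 2 * q $ 1"
proof -
  have e3: "vec4 0 0 0 1 \<noteq> (0 :: 'a ^ 4)"
    by (simp add: vec4_eq_iff)
  have "(\<exists>a b. vec4 0 0 0 1 = a *s p + b *s q) \<longleftrightarrow> p $ 1 * q $ 2 = p $ 2 * q $ 1"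
    if 0: "p $ 0 = 0" "q $ 0 = 0"
  proof
    assume "\<exists>a b. vec4 0 0 0 1 = a *s p + b *s q"
    then obtain a b where ab: "a * p $ 1 + b * q $ 1 = 0" "a * p $ 2 + b * q $ 2 = 0"
      "a * p $ 3 + b * q $ 3 = 1"
      by (auto simp: vec4_eq_iff)
    \<comment> \<open>By the third equation of \<open>ab\<close>, \<open>a\<close> and
      \<open>b\<close> are not both 0, so the determinant vanishes.\<close>
    have "a * (p $ 1 * q $ 2 - p $ 2 * q $ 1) = 0" "b * (p $ 1 * q $ 2 - p $ 2 * q $ 1) = 0"
      using ab(1,2) by algebra+
    with ab(3) show "p $ 1 * q $ 2 = p $ 2 * q $ 1" by auto
  next
    assume 12: "p $ 1 * q $ 2 = p $ 2 * q $ 1"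
    \<comment> \<open>The vector \<open>q\<^sub>k p - p\<^sub>k q\<close> has coordinates 0, 1 and 2
      equal to 0; dividing by its coordinate 3 gives the representative of Z.\<close>
    have comb: "\<exists>a b. vec4 0 0 0 1 = a *s p + b *s q"
      if "(q $ k) * p $ 3 - (p $ k) * q $ 3 \<noteq> 0" "k = 1 \<or> k = 2" for k
    proof (intro exI)
      have k: "q $ k * p $ 1 = p $ k * q $ 1" "q $ k * p $ 2 = p $ k * q $ 2"
        using that(2) 12 by (auto simp: mult.commute)
      let ?c = "(q $ k) * p $ 3 - (p $ k) * q $ 3"
      show "vec4 0 0 0 1 = (q $ k / ?c) *s p + (- p $ k / ?c) *s q"
        using that(1) 0 k by (simp add: vec4_eq_iff flip: diff_divide_distrib)
    qed
    have "p $ 1 * q $ 3 - p $ 3 * q $ 1 \<noteq> 0 \<or> p $ 2 * q $ 3 - p $ 3 * q $ 2 \<noteq> 0"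
      using assms 0 12 by (auto simp: vec6_eq_iff)
    then show "\<exists>a b. vec4 0 0 0 1 = a *s p + b *s q"
      using comb[of 1] comb[of 2] by (auto simp: algebra_simps)
  qed
  then show ?thesis
    using assms by (auto simp: pencil_def is_line_join join_subset_omega_iff pt_in_join e3)
qed

text \<open>Hence adding \<open>g_inf\<close> to the proper osculating tangents does not change
  their union with the pencil.\<close>

lemma g_inf_in_pencil: "g_inf \<in> pencil (pt (vec4 0 0 0 1)) omega"
  unfolding g_inf_eq_join by (subst join_in_pencil) (auto simp: vec6_eq_iff)

text \<open>The derivative by \<open>X 3\<close> is the negative square of \<open>X 0\<close>.
  Conversely, \<open>p\<^sub>0 = 0\<close> on the surface forces \<open>p\<^sub>1 = 0\<close>, and
  then all four derivatives vanish.\<close>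

lemma simple_point_pt:
  fixes p :: "'a::field ^ 4"
  assumes "p \<noteq> 0"
  shows "simple_point (pt p) \<longleftrightarrow> eval_poly cayley_poly p = 0 \<and> p $ 0 \<noteq> 0"
proof -
  have scale: "eval_poly cayley_poly (c *s p) = c ^ 3 * eval_poly cayley_poly p" for c
    by (simp add: eval_cayley algebra_simps power2_eq_square power3_eq_cube)
  have F: "pt p \<in> cayley_surface \<longleftrightarrow> eval_poly cayley_poly p = 0"
    using self_in_pt[of p] assms scale
    by (auto simp: cayley_surface_def zero_set_def is_point_pt) (auto simp: pt_eq)
  have "pt p \<in> zero_set (range (\<lambda>i. partial_deriv i cayley_poly)) \<longleftrightarrow> p $ 0 = 0"
    if f: "eval_poly cayley_poly p = 0"
  proof
    assume "pt p \<in> zero_set (range (\<lambda>i. partial_deriv i cayley_poly))"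
    then have "eval_poly (partial_deriv 3 cayley_poly) p = 0"
      using self_in_pt[of p] by (auto simp: zero_set_def)
    then show "p $ 0 = 0"
      by (simp add: eval_partial_deriv_cayley)
  next
    assume 0: "p $ 0 = 0"
    then have 1: "p $ 1 = 0"
      using f by (simp add: eval_cayley)
    have "eval_poly (partial_deriv i cayley_poly) (c *s p) = 0" for i c
    proof -
      have "i \<in> {0, 1, 2, 3}" using UNIV4 by auto
      then show ?thesis
        by (auto simp: eval_partial_deriv_cayley 0 1)
    qed
    then show "pt p \<in> zero_set (range (\<lambda>i. partial_deriv i cayley_poly))"
      by (auto simp: zero_set_def is_point_pt[OF assms]) (auto simp: pt_eq)
  qed
  then show ?thesis
    by (auto simp: simple_point_def F)
qed

text \<open>Modulo 3, the coefficients of T and T^2 in \<open>f(p + T q)\<close> yield relations in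
  Pluecker coordinates; the proofs display the multiples of 3 that drop out.\<close>

lemma osculating_tangent_pluecker:
  fixes p q :: "'a::field ^ 4"
  assumes three: "(3::'a) = 0" and p0: "p $ 0 \<noteq> 0"
    and dvd: "monom 1 3 dvd restrict_to_line cayley_poly p q"
  defines "y \<equiv> pluecker p q"
  shows "p $ 0 * y $ P03 = p $ 2 * y $ P01 + p $ 1 * y $ P02" "y $ P01 * y $ P02 = 0"
proof -
  have c1: "q $ 0 * p $ 1 * p $ 2 + p $ 0 * q $ 1 * p $ 2 + p $ 0 * p $ 1 * q $ 2
      - 3 * p $ 1 ^ 2 * q $ 1 - 2 * p $ 0 * q $ 0 * p $ 3 - p $ 0 ^ 2 * q $ 3 = 0"
    and c2: "p $ 0 * q $ 1 * q $ 2 + q $ 0 * p $ 1 * q $ 2 + q $ 0 * q $ 1 * p $ 2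
      - 3 * p $ 1 * q $ 1 ^ 2 - 2 * p $ 0 * q $ 0 * q $ 3 - q $ 0 ^ 2 * p $ 3 = 0"
    using dvd by (simp_all add: monom_3_dvd_restrict_cayley)
  show "p $ 0 * y $ P03 = p $ 2 * y $ P01 + p $ 1 * y $ P02"
  proof -
    have "p $ 0 * y $ P03 - (p $ 2 * y $ P01 + p $ 1 * y $ P02)
        = 3 * (p $ 1 * p $ 2 * q $ 0 - p $ 0 * p $ 3 * q $ 0 - p $ 1 ^ 2 * q $ 1)"
      unfolding y_def pluecker_nth using c1 by algebra
    then show ?thesis by (simp add: three)
  qed
  show "y $ P01 * y $ P02 = 0"
  proof -
    \<comment> \<open>The left side is \<open>p\<^sub>0\<close> times the T^2 coefficient plus
      \<open>q\<^sub>0\<close> times the T coefficient plus this multiple of 3.\<close>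
    have "y $ P01 * y $ P02 = 3 * (p $ 0 ^ 2 * q $ 0 * q $ 3 + p $ 0 * q $ 0 ^ 2 * p $ 3
        - p $ 0 * p $ 2 * q $ 0 * q $ 1 - p $ 0 * p $ 1 * q $ 0 * q $ 2
        + p $ 0 * p $ 1 * q $ 1 ^ 2 + p $ 1 ^ 2 * q $ 0 * q $ 1)"
      unfolding y_def pluecker_nth using c1 c2 by algebra
    then show ?thesis by (simp add: three)
  qed
qed

text \<open>The second spanning vector of a generator has zero coordinates 0 and 1. This serves to
  recognise tangents as proper.\<close>

lemma pluecker_generator:
  assumes "generator (join p q)"
  shows "pluecker p q $ P01 = 0"
proof -
  obtain s0 s1 where "join p q = join (vec4 (s0\<^sup>2) (s0 * s1) (s1\<^sup>2) 0) (vec4 0 0 s0 s1)"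
    using assms by (auto simp: generator_def)
  then obtain a b c d where
    "p = a *s vec4 (s0\<^sup>2) (s0 * s1) (s1\<^sup>2) 0 + b *s vec4 0 0 s0 s1"
    "q = c *s vec4 (s0\<^sup>2) (s0 * s1) (s1\<^sup>2) 0 + d *s vec4 0 0 s0 s1"
    by (rule join_eqD)
  then show ?thesis
    by (simp add: pluecker_combination)
qed

text \<open>The generator through \<open>p\<close> has the parameters
  \<open>(s\<^sub>0, s\<^sub>1) = (p\<^sub>0, p\<^sub>1)\<close>; the hypotheses place
  \<open>q\<close> on it as well.\<close>

lemma generatorI:
  fixes p q :: "'a::field ^ 4"
  assumes p0: "p $ 0 \<noteq> 0" and f: "eval_poly cayley_poly p = 0"
    and pq: "pluecker p q \<noteq> 0" "pluecker p q $ P01 = 0"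
      "p $ 0 * pluecker p q $ P03 = p $ 1 * pluecker p q $ P02"
  shows "generator (join p q)"
proof -
  \<comment> \<open>\<open>b\<close> and \<open>d\<close> are the coefficients of
    \<open>(0, 0, p\<^sub>0, p\<^sub>1)\<close> in \<open>p\<close> and \<open>q\<close>, read off
    from coordinate 2; coordinate 0 fixes the multiples of the other spanning vector.\<close>
  define b where "b = (p $ 2 - p $ 1 ^ 2 / p $ 0) / p $ 0"
  define d where "d = (q $ 2 - q $ 0 * p $ 1 ^ 2 / p $ 0 ^ 2) / p $ 0"
  have p3: "p $ 3 = b * p $ 1"
    using f p0 by (simp add: b_def eval_cayley field_simps power2_eq_square power3_eq_cube)
  have q1: "q $ 1 = p $ 1 * q $ 0 / p $ 0"
    using pq(2) p0 by (simp add: field_simps)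
  have p2: "p $ 2 = p $ 1 ^ 2 / p $ 0 + b * p $ 0"
    using p0 by (simp add: b_def)
  have q2: "q $ 2 = q $ 0 * p $ 1 ^ 2 / p $ 0 ^ 2 + d * p $ 0"
    using p0 by (simp add: d_def)
  have "p $ 0 * (p $ 0 * q $ 3 - p $ 3 * q $ 0) = p $ 1 * (p $ 0 * q $ 2 - p $ 2 * q $ 0)"
    using pq(3) by simp
  then have "p $ 0 ^ 2 * q $ 3 = p $ 0 ^ 2 * (d * p $ 1)"
    using p0 unfolding p3 p2 q2 by (simp add: field_simps power2_eq_square)
  then have q3: "q $ 3 = d * p $ 1"
    using p0 by simp
  have "join p q = join (vec4 (p $ 0 ^ 2) (p $ 0 * p $ 1) (p $ 1 ^ 2) 0) (vec4 0 0 (p $ 0) (p $ 1))"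
  proof (rule join_eqI[OF pq(1)])
    show "p = (1 / p $ 0) *s vec4 (p $ 0 ^ 2) (p $ 0 * p $ 1) (p $ 1 ^ 2) 0
        + b *s vec4 0 0 (p $ 0) (p $ 1)"
      using p0 p2 p3 by (simp add: vec4_eq_iff power2_eq_square)
    show "q = (q $ 0 / p $ 0 ^ 2) *s vec4 (p $ 0 ^ 2) (p $ 0 * p $ 1) (p $ 1 ^ 2) 0
        + d *s vec4 0 0 (p $ 0) (p $ 1)"
      using p0 q1 q2 q3 by (simp add: vec4_eq_iff power2_eq_square)
  qed
  then show ?thesis
    using p0 unfolding generator_def by blast
qed

lemma proper_osculating_tangentE:
  fixes t :: "('a::field, 4) point set"
  assumes three: "(3::'a) = 0" and "proper_osculating_tangent t"
  obtains p q where "t = join p q" "pluecker p q \<noteq> 0" "pluecker p q \<in> solid_vecs"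
    "p $ 0 \<noteq> 0" "eval_poly cayley_poly p = 0"
proof -
  obtain p q where simple: "simple_point (pt p)" and t: "t = join p q" and line: "is_line t"
    and dvd: "monom 1 3 dvd restrict_to_line cayley_poly p q" and gen: "\<not> generator t"
    using assms(2) by (auto simp: proper_osculating_tangent_def osculating_tangent_at_def)
  have pl: "pluecker p q \<noteq> 0"
    using line by (simp add: t is_line_join)
  then have "p \<noteq> 0"
    by (auto simp: pluecker_eq_0_iff)
  then have p: "eval_poly cayley_poly p = 0" "p $ 0 \<noteq> 0"
    using simple by (simp_all add: simple_point_pt)
  note y = osculating_tangent_pluecker[OF three p(2) dvd]
  have "pluecker p q $ P01 \<noteq> 0"
  proof
    assume "pluecker p q $ P01 = 0"
    with y(1) have "generator (join p q)"
      by (intro generatorI p pl) simp_all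
    with gen t show False by simp
  qed
  with y(2) have 02: "pluecker p q $ P02 = 0"
    by (simp del: pluecker_nth)
  \<comment> \<open>This combines \<open>y(1)\<close> with the identity \<open>p\<^sub>0
    y\<^sub>1\<^sub>2 - p\<^sub>1 y\<^sub>0\<^sub>2 + p\<^sub>2 y\<^sub>0\<^sub>1 =
    0\<close>.\<close>
  have "p $ 0 * (pluecker p q $ P03 + pluecker p q $ P12) = 0"
    using y(1) 02 by simp algebra
  with p(2) 02 have "pluecker p q \<in> solid_vecs"
    by (simp add: solid_vecs_def)
  with t pl p that show thesis by blast
qed

text \<open>The tangent with Pluecker coordinates \<open>(1, 0, c, -c, d, c\<^sup>2)\<close> osculates at
  \<open>P(u, c)\<close>, where \<open>u\<close> is the third root of \<open>d\<close>.\<close>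

lemma proper_osculating_tangentI:
  fixes c u :: "'a::field"
  assumes three: "(3::'a) = 0"
  shows "proper_osculating_tangent (join (vec4 1 0 c (- (u ^ 3))) (vec4 0 1 0 c))"
    (is "proper_osculating_tangent ?t")
proof -
  define p where "p = vec4 1 u c (u * c - u ^ 3)"
  define q where "q = vec4 0 1 0 c"
  have pl: "pluecker p q \<noteq> 0"
    by (auto simp: p_def q_def vec6_eq_iff)
  have t: "join p q = ?t"
    by (rule join_eqI[OF pl, of 1 _ u _ 0 1]) (simp_all add: p_def q_def vec4_eq_iff)
  have "simple_point (pt p)"
    by (subst simple_point_pt) (simp_all add: p_def eval_cayley vec4_eq_iff)
  \<comment> \<open>The coefficients of T and T^2 are \<open>- 3 u\<^sup>2\<close> and
    \<open>- 3 u\<close>.\<close>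
  moreover have "monom 1 3 dvd restrict_to_line cayley_poly p q"
    by (simp add: monom_3_dvd_restrict_cayley p_def q_def three)
  moreover have "\<not> generator (join p q)"
    using pluecker_generator[of p q] by (auto simp: p_def q_def)
  ultimately show ?thesis
    unfolding proper_osculating_tangent_def osculating_tangent_at_def t[symmetric]
    using is_line_join[of p q] pl by blast
qed

lemma solid_line_cases:
  assumes "pluecker p q \<noteq> 0" "pluecker p q \<in> solid_vecs"
  obtains "join p q \<in> pencil (pt (vec4 0 0 0 1)) omega"
  | c d where "join p q = join (vec4 1 0 c (- d)) (vec4 0 1 0 c)"
proof (cases "pluecker p q $ P01 = 0")
  case True
  have 02: "p $ 0 * q $ 2 = p $ 2 * q $ 0"
    and 0312: "p $ 0 * q $ 3 - p $ 3 * q $ 0 + (p $ 1 * q $ 2 - p $ 2 * q $ 1) = 0"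
    using assms(2) by (simp_all add: solid_vecs_def)
  have 01: "p $ 0 * q $ 1 = p $ 1 * q $ 0"
    using True by simp
  \<comment> \<open>With \<open>y\<^sub>0\<^sub>1 = y\<^sub>0\<^sub>2 = 0\<close> and
    \<open>y\<^sub>0\<^sub>3 = - y\<^sub>1\<^sub>2\<close> the Pluecker relation becomes this
    square.\<close>
  have "(p $ 1 * q $ 2 - p $ 2 * q $ 1)\<^sup>2 = 0"
    using 01 02 0312 by algebra
  then have 12: "p $ 1 * q $ 2 = p $ 2 * q $ 1"
    by simp
  then have 03: "p $ 0 * q $ 3 = p $ 3 * q $ 0"
    using 0312 by simp
  \<comment> \<open>A nonzero coordinate 0 of \<open>p\<close> or \<open>q\<close> would kill the
    two remaining Pluecker coordinates, so the line lies in the plane \<open>omega\<close>.\<close>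
  have "r = 0 \<or> pluecker p q = 0"
    if r: "r = p $ 0 \<or> r = q $ 0" for r
  proof -
    have "r * pluecker p q $ P13 = 0" "r * pluecker p q $ P23 = 0"
      unfolding pluecker_nth using r 01 02 03 by (elim disjE; algebra)+
    then show ?thesis
      using 01 02 03 12 by (auto simp: vec6_eq_iff)
  qed
  then have "join p q \<in> pencil (pt (vec4 0 0 0 1)) omega"
    using assms(1) 12 by (auto simp: join_in_pencil)
  then show thesis by (rule that(1))
next
  case False
  define a where "a = p $ 0 * q $ 1 - p $ 1 * q $ 0"
  \<comment> \<open>The target line has Pluecker coordinates
    \<open>(1, 0, c, -c, d, c\<^sup>2)\<close>, so \<open>c\<close> and \<open>d\<close> are
    coordinates \<open>P03\<close> and \<open>P13\<close> after division by coordinate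
    \<open>P01\<close>.\<close>
  define c where "c = (p $ 0 * q $ 3 - p $ 3 * q $ 0) / a"
  define d where "d = (p $ 1 * q $ 3 - p $ 3 * q $ 1) / a"
  have a: "a \<noteq> 0"
    using False by (simp add: a_def)
  have 02: "p $ 0 * q $ 2 = p $ 2 * q $ 0"
    and 12: "p $ 0 * q $ 3 - p $ 3 * q $ 0 + (p $ 1 * q $ 2 - p $ 2 * q $ 1) = 0"
    using assms(2) by (simp_all add: solid_vecs_def)
  \<comment> \<open>The factor \<open>a\<close> clears the denominators of \<open>c\<close> and
    \<open>d\<close>, so that \<open>algebra\<close> works with polynomial identities.\<close>
  have "a * p $ 2 = a * (p $ 0 * c)" "a * p $ 3 = a * (p $ 1 * c - p $ 0 * d)"
    "a * q $ 2 = a * (q $ 0 * c)" "a * q $ 3 = a * (q $ 1 * c - q $ 0 * d)"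
  proof -
    have c: "a * c = p $ 0 * q $ 3 - p $ 3 * q $ 0" and d: "a * d = p $ 1 * q $ 3 - p $ 3 * q $ 1"
      using a by (simp_all add: c_def d_def)
    show "a * p $ 2 = a * (p $ 0 * c)"
      using c 02 12 a_def by algebra
    show "a * p $ 3 = a * (p $ 1 * c - p $ 0 * d)"
      using c d a_def by algebra
    show "a * q $ 2 = a * (q $ 0 * c)"
      using c 02 12 a_def by algebra
    show "a * q $ 3 = a * (q $ 1 * c - q $ 0 * d)"
      using c d a_def by algebra
  qed
  then have "p $ 2 = p $ 0 * c" "p $ 3 = p $ 1 * c - p $ 0 * d" "q $ 2 = q $ 0 * c" "q $ 3 = q $ 1 * c - q $ 0 * d"
    using a by simp_all
  then have "join p q = join (vec4 1 0 c (- d)) (vec4 0 1 0 c)"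
    by (intro join_eqI[OF assms(1), of "p $ 0" _ "p $ 1" _ "q $ 0" "q $ 1"])
      (simp_all add: vec4_eq_iff)
  then show thesis by (rule that(2))
qed

section \<open>The parabolic congruence\<close>

text \<open>The witness for the congruence N, taken as the full preimage of the solid under
  \<open>klein\<close>.\<close>

definition cayley_congruence :: "('a::field, 4) point set set" where
  "cayley_congruence = {l. is_line l \<and> klein l \<in> points_of solid_vecs}"

lemma join_in_cayley_congruence:
  assumes "pluecker p q \<noteq> 0"
  shows "join p q \<in> cayley_congruence \<longleftrightarrow> pluecker p q \<in> solid_vecs"
  using assms
  by (simp add: cayley_congruence_def is_line_join klein_join pt_in_points_of subspace_solid_vecs)

lemma klein_image_cayley_congruence: "klein ` cayley_congruence = klein_quadric \<inter> points_of solid_vecs"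
proof (intro equalityI subsetI)
  fix P :: "('a, pindex) point"
  assume "P \<in> klein ` cayley_congruence"
  then obtain l where l: "l \<in> cayley_congruence" "P = klein l" by blast
  then obtain p q where pq: "l = join p q" "pluecker p q \<noteq> 0"
    by (auto simp: cayley_congruence_def elim: is_lineE)
  have "pluecker p q $ P01 * pluecker p q $ P23 - pluecker p q $ P02 * pluecker p q $ P13
      + pluecker p q $ P03 * pluecker p q $ P12 = 0"
    by (simp add: algebra_simps)
  with l pq show "P \<in> klein_quadric \<inter> points_of solid_vecs"
    by (simp add: cayley_congruence_def klein_join pt_in_klein_quadric del: pluecker_nth)
next
  fix P :: "('a, pindex) point"
  assume P: "P \<in> klein_quadric \<inter> points_of solid_vecs"
  then obtain y where y: "y \<noteq> 0" "P = pt y" "y \<in> solid_vecs"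
    by (blast elim: points_of_E)
  have y02: "y $ P02 = 0" and y12: "y $ P12 = - y $ P03"
    using y(3) by (simp_all add: solid_vecs_def eq_neg_iff_add_eq_0 add.commute)
  have Q: "y $ P01 * y $ P23 = y $ P03 * y $ P03"
    using P y y02 y12 by (simp add: pt_in_klein_quadric)
  have "\<exists>p q c. y = c *s pluecker p q"
  proof (cases "y $ P01 = 0")
    case True
    \<comment> \<open>Here \<open>Q\<close> forces coordinate \<open>P03\<close> to be 0, so only
      \<open>P13\<close> and \<open>P23\<close> remain: a line through Z in
      \<open>omega\<close>.\<close>
    then have "y = 1 *s pluecker (vec4 0 (y $ P13) (y $ P23) 0) (vec4 0 0 0 1)"
      using Q y02 y12 by (simp add: vec6_eq_iff)
    then show ?thesis by blast
  next
    case False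
    then have "y = y $ P01 *s pluecker (vec4 1 0 (y $ P03 / y $ P01) (- (y $ P13 / y $ P01)))
        (vec4 0 1 0 (y $ P03 / y $ P01))"
      using Q y02 y12 by (simp add: vec6_eq_iff field_simps)
    then show ?thesis by blast
  qed
  then obtain p q c where pq: "y = c *s pluecker p q" by blast
  with y(1) have c: "c \<noteq> 0" "pluecker p q \<noteq> 0" by auto
  then have "P = klein (join p q)"
    using pq y(2) by (simp add: klein_join pt_scale)
  moreover have "join p q \<in> cayley_congruence"
    using P calculation c by (simp add: cayley_congruence_def is_line_join)
  ultimately show "P \<in> klein ` cayley_congruence" by blast
qed

lemma parabolic_cayley_congruence: "parabolic_linear_congruence cayley_congruence"
  unfolding parabolic_linear_congruence_def
  using parabolic_solid klein_image_cayley_congruence by (auto simp: cayley_congruence_def)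

section \<open>The axis of the congruence\<close>

lemma klein_line_of_nuclei: "klein line_of_nuclei = pt (vec6 0 0 0 0 1 (0::'a::field))"
proof -
  have pl: "pluecker (vec4 0 1 0 0) (vec4 0 0 0 1) = vec6 0 0 0 0 1 (0::'a)"
    by (simp add: vec6_eq_iff)
  have "vec6 0 0 0 0 1 0 \<noteq> (0 :: 'a ^ pindex)"
    by (simp add: vec6_eq_iff)
  then show ?thesis
    by (simp add: line_of_nuclei_eq_join klein_join pl)
qed

text \<open>Injectivity of \<open>klein\<close> over the vertex, which makes the axis
  unique.\<close>

lemma klein_eq_line_of_nuclei:
  assumes "is_line l" "klein l = klein line_of_nuclei"
  shows "l = line_of_nuclei"
proof -
  obtain p q where l: "l = join p q" and pl: "pluecker p q \<noteq> 0"
    using assms(1) by (rule is_lineE)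
  then have "pluecker p q \<in> pt (vec6 0 0 0 0 1 0)"
    using assms(2) self_in_pt[of "pluecker p q"] by (simp add: klein_line_of_nuclei klein_join)
  then obtain d where y: "pluecker p q = d *s vec6 0 0 0 0 1 0"
    by (auto simp: pt_eq)
  then have d: "p $ 1 * q $ 3 - p $ 3 * q $ 1 = d" and 0:
    "p $ 0 * q $ 1 - p $ 1 * q $ 0 = 0" "p $ 0 * q $ 3 - p $ 3 * q $ 0 = 0"
    "p $ 1 * q $ 2 - p $ 2 * q $ 1 = 0" "p $ 2 * q $ 3 - p $ 3 * q $ 2 = 0"
    by (simp_all add: vec6_eq_iff)
  have "d * p $ 0 = 0" "d * q $ 0 = 0" "d * p $ 2 = 0" "d * q $ 2 = 0"
    unfolding d[symmetric] using 0 by algebra+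
  moreover have "d \<noteq> 0"
    using y pl by auto
  ultimately have "p $ 0 = 0" "q $ 0 = 0" "p $ 2 = 0" "q $ 2 = 0" by auto
  then show ?thesis
    unfolding l line_of_nuclei_eq_join
    by (intro join_eqI[OF pl, of "p $ 1" _ "p $ 3" _ "q $ 1" "q $ 3"]) (simp_all add: vec4_eq_iff)
qed

text \<open>The definition of the axis allows any parabolic solid with the same quadric section;
  \<open>solid_unique\<close> leaves only one.\<close>

lemma congruence_axis_cayley_congruence: "congruence_axis cayley_congruence = line_of_nuclei"
  unfolding congruence_axis_def
proof (rule the_equality)
  have "is_line line_of_nuclei"
    unfolding line_of_nuclei_eq_join is_line_join by (simp add: vec6_eq_iff)
  then show "is_line line_of_nuclei \<and> (\<exists>D. parabolic_solid D \<and>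
      klein ` cayley_congruence = klein_quadric \<inter> D \<and> perp D \<inter> klein_quadric = {klein line_of_nuclei})"
    using parabolic_solid klein_image_cayley_congruence perp_solid_Int_klein_quadric
    by (auto simp: perp_solid klein_line_of_nuclei intro!: exI[of _ "points_of solid_vecs"])
next
  fix a :: "('a, 4) point set"
  assume "is_line a \<and> (\<exists>D. parabolic_solid D \<and>
      klein ` cayley_congruence = klein_quadric \<inter> D \<and> perp D \<inter> klein_quadric = {klein a})"
  then obtain D where a: "is_line a" "perp D \<inter> klein_quadric = {klein a}"
    and D: "parabolic_solid D" "klein_quadric \<inter> points_of solid_vecs = klein_quadric \<inter> D"
    by (auto simp: klein_image_cayley_congruence)
  have "D = points_of solid_vecs"
    using D by (intro solid_unique) (auto simp: parabolic_solid_def)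
  then have "klein a = klein line_of_nuclei"
    using a(2) by (simp add: perp_solid perp_solid_Int_klein_quadric klein_line_of_nuclei)
  with a(1) show "a = line_of_nuclei"
    by (rule klein_eq_line_of_nuclei)
qed

section \<open>Comparison with the osculating tangents and the pencil\<close>

lemma pencil_subset_cayley_congruence: "pencil (pt (vec4 0 0 0 1)) omega \<subseteq> cayley_congruence"
proof
  fix l :: "('a, 4) point set"
  assume l: "l \<in> pencil (pt (vec4 0 0 0 1)) omega"
  then obtain p q where pq: "l = join p q" "pluecker p q \<noteq> 0"
    by (auto simp: pencil_def elim: is_lineE)
  with l have "p $ 0 = 0" "q $ 0 = 0" "p $ 1 * q $ 2 = p $ 2 * q $ 1"
    by (auto simp: join_in_pencil)
  with pq show "l \<in> cayley_congruence"
    by (simp add: join_in_cayley_congruence) (simp add: solid_vecs_def)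
qed

lemma proper_osculating_tangent_in_cayley_congruence:
  fixes t :: "('a::field, 4) point set"
  assumes "(3::'a) = 0" "proper_osculating_tangent t"
  shows "t \<in> cayley_congruence"
  using proper_osculating_tangentE[OF assms] join_in_cayley_congruence by metis

lemma cayley_congruence_eq_iff:
  assumes three: "(3::'a::field) = 0"
  shows "cayley_congruence = {t. proper_osculating_tangent t} \<union> pencil (pt (vec4 0 0 0 1 :: 'a ^ 4)) omega
    \<longleftrightarrow> (\<forall>a::'a. \<exists>b. b ^ 3 = a)"
proof
  assume eq: "cayley_congruence = {t. proper_osculating_tangent t} \<union> pencil (pt (vec4 0 0 0 1 :: 'a ^ 4)) omega"
  show "\<forall>a::'a. \<exists>b. b ^ 3 = a"
  proof
    fix a :: 'a
    \<comment> \<open>The test line is the one with \<open>c = 0\<close> and \<open>d = a\<close>: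
      it lies in the congruence for every \<open>a\<close>.\<close>
    let ?p = "vec4 1 0 0 (- a)" and ?q = "vec4 0 1 0 (0::'a)"
    have pl: "pluecker ?p ?q \<noteq> 0" "pluecker ?p ?q \<in> solid_vecs"
      by (simp_all add: vec6_eq_iff solid_vecs_def)
    have "join ?p ?q \<notin> pencil (pt (vec4 0 0 0 1)) omega"
      by (simp add: join_in_pencil[OF pl(1)])
    then have "proper_osculating_tangent (join ?p ?q)"
      using pl join_in_cayley_congruence[OF pl(1)] unfolding eq by blast
    then obtain p q where pq: "join ?p ?q = join p q" and p0: "p $ 0 \<noteq> 0"
      and f: "eval_poly cayley_poly p = 0"
      using proper_osculating_tangentE[OF three] by metis
    obtain b c where "p = b *s ?p + c *s ?q"
      using pq[symmetric] by (rule join_eqD)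
    then have p: "p $ 0 = b" "p $ 1 = c" "p $ 2 = 0" "p $ 3 = - (b * a)"
      by simp_all
    \<comment> \<open>This is the surface equation at the point of contact; \<open>b\<close> is its
      nonzero coordinate 0.\<close>
    have "c ^ 3 = b ^ 3 * a"
      using f by (simp add: eval_cayley p power2_eq_square power3_eq_cube algebra_simps)
    then have "(c / b) ^ 3 = a"
      using p0 by (simp add: p power_divide)
    then show "\<exists>b. b ^ 3 = a" ..
  qed
next
  assume roots: "\<forall>a::'a. \<exists>b. b ^ 3 = a"
  show "cayley_congruence = {t. proper_osculating_tangent t} \<union> pencil (pt (vec4 0 0 0 1 :: 'a ^ 4)) omega"
  proof (intro equalityI subsetI)
    fix l :: "('a, 4) point set"
    assume l: "l \<in> cayley_congruence"
    then obtain p q where pq: "l = join p q" "pluecker p q \<noteq> 0"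
      by (auto simp: cayley_congruence_def elim: is_lineE)
    with l have "pluecker p q \<in> solid_vecs"
      by (simp add: join_in_cayley_congruence)
    with pq(2) show "l \<in> {t. proper_osculating_tangent t} \<union> pencil (pt (vec4 0 0 0 1)) omega"
    proof (cases rule: solid_line_cases)
      case (2 c d)
      obtain u where "u ^ 3 = d" using roots by blast
      with 2 pq(1) proper_osculating_tangentI[OF three, of c u] show ?thesis by simp
    qed (simp add: pq(1))
  next
    fix l :: "('a, 4) point set"
    assume "l \<in> {t. proper_osculating_tangent t} \<union> pencil (pt (vec4 0 0 0 1)) omega"
    then show "l \<in> cayley_congruence"
    proof
      assume "l \<in> {t. proper_osculating_tangent t}"
      then show ?thesis
        using proper_osculating_tangent_in_cayley_congruence[OF three] by blast
    qed (use pencil_subset_cayley_congruence in blast)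
  qed
qed

theorem theorem4p7:
  fixes D :: "('a::field, pindex) point set"
  assumes "CHAR('a) = 3"
    and "D = zero_set {Y P02, Y P03 + Y P12}"
  shows "is_proj_subspace 3 D \<and>
    quadratic_cone (klein_quadric \<inter> D) \<and>
    (\<exists>N. parabolic_linear_congruence N \<and>
         osculating_lines \<union> pencil (pt (vec4 0 0 0 1)) omega \<subseteq> N \<and>
         klein ` N = klein_quadric \<inter> D \<and>
         congruence_axis N = line_of_nuclei \<and>
         (N = osculating_lines \<union> pencil (pt (vec4 0 0 0 1)) omega
            \<longleftrightarrow> (\<forall>a::'a. \<exists>b. b ^ 3 = a)))"
proof -
  have three: "(3::'a) = 0"
    using of_nat_CHAR[where 'a = 'a] assms(1) by simp
  have two: "(2::'a) \<noteq> 0"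
  proof
    assume "(2::'a) = 0"
    \<comment> \<open>If 2 = 0 then 3 = 1, contradicting 3 = 0.\<close>
    then have "(2::'a) + 1 = 1" by simp
    with three show False by simp
  qed
  have D: "D = points_of solid_vecs"
    by (simp add: assms(2) solid_eq)
  have union: "osculating_lines \<union> pencil (pt (vec4 0 0 0 1)) omega
      = {t :: ('a, 4) point set. proper_osculating_tangent t} \<union> pencil (pt (vec4 0 0 0 1)) omega"
    using g_inf_in_pencil by (auto simp: osculating_lines_def)
  have "osculating_lines \<union> pencil (pt (vec4 0 0 0 1 :: 'a ^ 4)) omega \<subseteq> cayley_congruence"
    unfolding union
    using pencil_subset_cayley_congruence proper_osculating_tangent_in_cayley_congruence[OF three] by blast
  then show ?thesis
    unfolding D using is_proj_subspace_solid quadratic_cone_klein_quadric_solid[OF two]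
      parabolic_cayley_congruence klein_image_cayley_congruence congruence_axis_cayley_congruence
      cayley_congruence_eq_iff[OF three, folded union]
    by blast
qed

end
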